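(* Let $r, d$ be positive integers and let $\mathcal{F}$ be a family of $(r-1)\left(\frac{d(d+3)}{2}+1\right)+1$ sets in $\mathbb{R}^d$, each of volume one. Then there exists a partition of $\mathcal{F}$ into $r$ parts $\mathcal{A}_1, \ldots, \mathcal{A}_r$ such that the volume of $\bigcap_{j=1}^r \operatorname{conv}\left(\bigcup \mathcal{A}_j\right)$ is at least $d^{-d}$.
   Context: $\operatorname{conv}$ denotes the convex hull, and $\bigcup \mathcal{A}_j$ denotes the union of the sets in $\mathcal{A}_j$. Volume means $d$-dimensional Lebesgue measure. *)

theory Defs
  imports "HOL-Analysis.Analysis"
begin

end

theory Submission
  imports Defs
begin

text \<open>
  By John's theorem the closure of the convex hull of a set of volume one contains an ellipsoid
  \<open>{a + A y | y. norm y \<le> 1}\<close> of volume at least \<open>d\<^sup>-\<^sup>d\<close>, where \<open>A\<close> may be taken symmetric and positive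
  semidefinite by the polar decomposition. The pairs \<open>(A, a)\<close> lie in a space of dimension
  \<open>d (d + 3) / 2\<close>, so Tverberg's theorem partitions them into \<open>r\<close> parts whose convex hulls share a point
  \<open>(S, s)\<close>. The pairs whose ellipsoid lies in a given convex set form a convex set, and so do the positive
  semidefinite matrices of determinant at least \<open>\<kappa>\<close>; hence the ellipsoid of \<open>(S, s)\<close> has volume at
  least \<open>d\<^sup>-\<^sup>d\<close> and lies in the closed convex hull of the union of each part. Tverberg's theorem itself
  follows from Sarkaria's tensor trick combined with Barany's descent: a colouring and weights of least
  imbalance are balanced.
\<close>

section \<open>Tverberg's theorem\<close>

lemma nonneg_if_nonneg_perturbations:
  fixes a b :: real
  assumes "\<And>t. 0 < t \<Longrightarrow> t < 1 \<Longrightarrow> 0 \<le> a + t * b"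
  shows "0 \<le> a"
proof (rule tendsto_lowerbound)
  show "((\<lambda>t. a + t * b) \<longlongrightarrow> a) (at_right 0)"
    by (auto intro!: tendsto_eq_intros)
  have "\<forall>\<^sub>F t::real in at_right 0. t \<in> {0<..<1}"
    by (rule eventually_at_right_real) simp
  then show "\<forall>\<^sub>F t in at_right 0. 0 \<le> a + t * b"
    by (rule eventually_mono) (use assms in auto)
qed auto

lemma homogeneous_system_nontrivial_solution:
  fixes m :: "'i \<Rightarrow> 'k \<Rightarrow> real"
  assumes "finite K" "finite I" "card K < card I"
  shows "\<exists>\<beta>. (\<exists>i\<in>I. \<beta> i \<noteq> 0) \<and> (\<forall>k\<in>K. (\<Sum>i\<in>I. \<beta> i * m i k) = 0)"
  using assms
proof (induction K arbitrary: I m rule: finite_induct)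
  case empty
  then have "I \<noteq> {}" by auto
  then show ?case by (intro exI[of _ "\<lambda>_. 1"]) auto
next
  case (insert k K)
  show ?case
  proof (cases "\<forall>i\<in>I. m i k = 0")
    case True
    moreover obtain \<beta> where "\<exists>i\<in>I. \<beta> i \<noteq> 0" "\<forall>l\<in>K. (\<Sum>i\<in>I. \<beta> i * m i l) = 0"
      using insert.IH[of I m] insert.prems insert.hyps by auto
    ultimately show ?thesis by (intro exI[of _ \<beta>]) auto
  next
    case False
    then obtain p where p: "p \<in> I" "m p k \<noteq> 0" by auto
    define m' where "m' i l = m i l - m i k / m p k * m p l" for i l
    have "card K < card (I - {p})" "finite (I - {p})"
      using insert.prems insert.hyps p by auto
    then obtain \<beta> where \<beta>: "\<exists>i\<in>I - {p}. \<beta> i \<noteq> 0" "\<And>l. l \<in> K \<Longrightarrow> (\<Sum>i\<in>I - {p}. \<beta> i * m' i l) = 0"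
      using insert.IH[of "I - {p}" m'] by auto
    define \<gamma> where "\<gamma> = \<beta>(p := - (\<Sum>i\<in>I - {p}. \<beta> i * (m i k / m p k)))"
    have eliminated: "(\<Sum>i\<in>I. \<gamma> i * m i l) = (\<Sum>i\<in>I - {p}. \<beta> i * m' i l)" for l
    proof -
      have "(\<Sum>i\<in>I. \<gamma> i * m i l) = \<gamma> p * m p l + (\<Sum>i\<in>I - {p}. \<beta> i * m i l)"
        using insert.prems p by (subst sum.remove[of I p]) (auto simp: \<gamma>_def intro!: sum.cong)
      then show ?thesis
        by (simp add: \<gamma>_def m'_def right_diff_distrib sum_subtractf sum_distrib_right mult.assoc)
    qed
    have "(\<Sum>i\<in>I. \<gamma> i * m i l) = 0" if "l \<in> insert k K" for l
      using that \<beta>(2) p unfolding eliminated by (auto simp: m'_def)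
    moreover have "\<exists>i\<in>I. \<gamma> i \<noteq> 0" using \<beta>(1) by (auto simp: \<gamma>_def)
    ultimately show ?thesis by blast
  qed
qed

lemma nonneg_line_meets_boundary:
  fixes a b :: "'i \<Rightarrow> real"
  assumes "finite I" and a: "\<And>i. i \<in> I \<Longrightarrow> 0 \<le> a i" and b: "\<exists>i\<in>I. b i < 0"
  obtains t where "\<And>i. i \<in> I \<Longrightarrow> 0 \<le> a i + t * b i" "\<exists>i\<in>I. a i + t * b i = 0"
proof -
  define N where "N = {i\<in>I. b i < 0}"
  have "finite N" "N \<noteq> {}" using \<open>finite I\<close> b by (auto simp: N_def)
  then obtain l where l: "l \<in> N" "\<And>i. i \<in> N \<Longrightarrow> a l / (- b l) \<le> a i / (- b i)"
    using arg_min_if_finite[of N "\<lambda>i. a i / (- b i)"] by (metis leI)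
  define t where "t = a l / (- b l)"
  have "l \<in> I" "b l < 0" using l(1) by (auto simp: N_def)
  have "0 \<le> a i + t * b i" if "i \<in> I" for i
  proof (cases "b i < 0")
    case True
    then have "t \<le> a i / (- b i)" using l(2)[of i] that by (simp add: N_def t_def)
    then show ?thesis using True by (simp add: field_simps)
  next
    case False
    have "0 \<le> t" using a[OF \<open>l \<in> I\<close>] \<open>b l < 0\<close> by (simp add: t_def divide_nonneg_neg)
    with False a[OF that] show ?thesis by simp
  qed
  moreover have "a l + t * b l = 0" using \<open>b l < 0\<close> by (simp add: t_def)
  ultimately show thesis using that \<open>l \<in> I\<close> by blast
qed

definition simplex_weights :: "'i set \<Rightarrow> ('i \<Rightarrow> real) set" where
  "simplex_weights I = {\<alpha>. (\<forall>i\<in>I. 0 \<le> \<alpha> i) \<and> sum \<alpha> I = 1 \<and> (\<forall>i. i \<notin> I \<longrightarrow> \<alpha> i = 0)}"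

lemma compact_simplex_weights:
  fixes I :: "'i set"
  assumes "finite I"
  shows "compact (simplex_weights I)"
proof -
  let ?P = "PiE UNIV (\<lambda>i. if i \<in> I then {0..1} else {0}) :: ('i \<Rightarrow> real) set"
  have "compactin (product_topology (\<lambda>_. euclidean) UNIV) ?P"
    unfolding compactin_PiE by auto
  then have "compact ?P"
    by (simp add: euclidean_product_topology)
  moreover have "closed {\<alpha> :: 'i \<Rightarrow> real. sum \<alpha> I = 1}"
    by (intro closed_Collect_eq continuous_intros continuous_on_product_coordinates)
  ultimately have "compact (?P \<inter> {\<alpha>. sum \<alpha> I = 1})"
    by (rule compact_Int_closed)
  moreover have "simplex_weights I = ?P \<inter> {\<alpha>. sum \<alpha> I = 1}"
  proof (intro equalityI subsetI)
    fix \<alpha> assume "\<alpha> \<in> simplex_weights I"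
    moreover from this have "\<alpha> i \<le> 1" if "i \<in> I" for i
      using member_le_sum[of i I \<alpha>] assms that by (auto simp: simplex_weights_def)
    ultimately show "\<alpha> \<in> ?P \<inter> {\<alpha>. sum \<alpha> I = 1}" by (auto simp: simplex_weights_def PiE_iff)
  next
    fix \<alpha> assume "\<alpha> \<in> ?P \<inter> {\<alpha>. sum \<alpha> I = 1}"
    then have "\<alpha> i \<in> (if i \<in> I then {0..1} else {0})" "sum \<alpha> I = 1" for i
      by (auto simp: PiE_iff)
    then show "\<alpha> \<in> simplex_weights I" by (fastforce simp: simplex_weights_def split: if_splits)
  qed
  ultimately show ?thesis by simp
qed

locale coloured_vectors =
  fixes y :: "'i \<Rightarrow> 'a::euclidean_space" and I :: "'i set" and r :: nat
  assumes finite_indices: "finite I" and colour_exists: "0 < r"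
begin

definition colourings :: "('i \<Rightarrow> nat) set" where
  "colourings = I \<rightarrow>\<^sub>E {..<r}"

text \<open>Sarkaria's tensor trick: \<open>deviation f \<alpha>\<close> lists the components of the sum over \<open>i\<close> of
  \<open>\<alpha> i\<close> times the tensor product of \<open>y i\<close> with \<open>e\<^sub>c - (e\<^sub>0 + \<dots> + e\<^sub>r\<^sub>-\<^sub>1) / r\<close>, where \<open>c = f i\<close>.\<close>

definition deviation :: "('i \<Rightarrow> nat) \<Rightarrow> ('i \<Rightarrow> real) \<Rightarrow> nat \<Rightarrow> 'a" where
  "deviation f \<alpha> j = (\<Sum>i\<in>I. (\<alpha> i * (of_bool (f i = j) - 1 / r)) *\<^sub>R y i)"

definition imbalance :: "('i \<Rightarrow> nat) \<Rightarrow> ('i \<Rightarrow> real) \<Rightarrow> real" where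
  "imbalance f \<alpha> = (\<Sum>j<r. deviation f \<alpha> j \<bullet> deviation f \<alpha> j)"

lemma deviation_eq_class_sum_diff:
  "deviation f \<alpha> j = (\<Sum>i | i \<in> I \<and> f i = j. \<alpha> i *\<^sub>R y i) - (\<Sum>i\<in>I. \<alpha> i *\<^sub>R y i) /\<^sub>R r"
proof -
  have "deviation f \<alpha> j = (\<Sum>i\<in>I. (if f i = j then \<alpha> i *\<^sub>R y i else 0) - (\<alpha> i *\<^sub>R y i) /\<^sub>R r)"
    unfolding deviation_def by (intro sum.cong) (auto simp: algebra_simps divide_inverse)
  then show ?thesis
    using finite_indices by (simp add: sum_subtractf sum.inter_filter scaleR_sum_right)
qed

lemma deviation_line: "deviation f (\<lambda>i. \<alpha> i + t * \<beta> i) j = deviation f \<alpha> j + t *\<^sub>R deviation f \<beta> j"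
  by (simp add: deviation_def scaleR_sum_right sum.distrib[symmetric] algebra_simps)

lemma sum_inner_deviation:
  assumes "f \<in> colourings" and "(\<Sum>j<r. w j) = 0"
  shows "(\<Sum>j<r. w j \<bullet> deviation f \<alpha> j) = (\<Sum>i\<in>I. \<alpha> i * (w (f i) \<bullet> y i))"
proof -
  have "(\<Sum>j<r. w j \<bullet> deviation f \<alpha> j) =
      (\<Sum>i\<in>I. \<alpha> i * ((\<Sum>j<r. (of_bool (f i = j) - 1 / r) *\<^sub>R w j) \<bullet> y i))"
    unfolding deviation_def inner_sum_right inner_sum_left sum_distrib_left
    by (subst sum.swap) (simp add: mult.assoc)
  moreover have "(\<Sum>j<r. (of_bool (f i = j) - 1 / r) *\<^sub>R w j) = w (f i)" if "i \<in> I" for i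
  proof -
    have "f i < r" using assms(1) that by (auto simp: colourings_def)
    moreover have "(\<Sum>j<r. (of_bool (f i = j) - 1 / r) *\<^sub>R w j) =
        (\<Sum>j<r. if f i = j then w j else 0) - (1 / r) *\<^sub>R (\<Sum>j<r. w j)"
      unfolding scaleR_sum_right sum_subtractf[symmetric] by (intro sum.cong) (auto simp: algebra_simps)
    ultimately show ?thesis by (simp add: assms(2))
  qed
  ultimately show ?thesis by simp
qed

lemma sum_deviation:
  assumes "f \<in> colourings"
  shows "(\<Sum>j<r. deviation f \<alpha> j) = 0"
proof -
  have "(\<Sum>j<r. \<Sum>i | i \<in> I \<and> f i = j. \<alpha> i *\<^sub>R y i) = (\<Sum>i\<in>I. \<alpha> i *\<^sub>R y i)"
    using assms finite_indices by (intro sum.group) (auto simp: colourings_def)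
  then show ?thesis
    using colour_exists by (simp add: deviation_eq_class_sum_diff sum_subtractf sum_constant_scaleR)
qed

lemma imbalance_nonneg: "0 \<le> imbalance f \<alpha>"
  by (simp add: imbalance_def sum_nonneg)

lemma imbalance_eq_weighted_sum:
  assumes "f \<in> colourings"
  shows "imbalance f \<alpha> = (\<Sum>i\<in>I. \<alpha> i * (deviation f \<alpha> (f i) \<bullet> y i))"
  unfolding imbalance_def by (rule sum_inner_deviation[OF assms sum_deviation[OF assms]])

lemma imbalance_line:
  assumes "f \<in> colourings"
  shows "imbalance f (\<lambda>i. \<alpha> i + t * \<beta> i) =
    imbalance f \<alpha> + 2 * t * (\<Sum>i\<in>I. \<beta> i * (deviation f \<alpha> (f i) \<bullet> y i)) + t\<^sup>2 * imbalance f \<beta>"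
proof -
  have "imbalance f (\<lambda>i. \<alpha> i + t * \<beta> i) = (\<Sum>j<r. deviation f \<alpha> j \<bullet> deviation f \<alpha> j
      + 2 * t * (deviation f \<alpha> j \<bullet> deviation f \<beta> j) + t\<^sup>2 * (deviation f \<beta> j \<bullet> deviation f \<beta> j))"
    unfolding imbalance_def deviation_line
    by (intro sum.cong) (auto simp: inner_simps inner_commute power2_eq_square algebra_simps)
  also have "\<dots> = imbalance f \<alpha> + 2 * t * (\<Sum>j<r. deviation f \<alpha> j \<bullet> deviation f \<beta> j) + t\<^sup>2 * imbalance f \<beta>"
    by (simp add: imbalance_def sum.distrib sum_distrib_left)
  finally show ?thesis
    by (simp only: sum_inner_deviation[OF assms sum_deviation[OF assms]])
qed

definition minimizes_imbalance :: "('i \<Rightarrow> nat) \<Rightarrow> ('i \<Rightarrow> real) \<Rightarrow> bool" where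
  "minimizes_imbalance f \<alpha> \<longleftrightarrow> f \<in> colourings \<and> \<alpha> \<in> simplex_weights I \<and>
    (\<forall>g\<in>colourings. \<forall>\<beta>\<in>simplex_weights I. imbalance f \<alpha> \<le> imbalance g \<beta>)"

lemma ex_imbalance_minimizer:
  assumes "I \<noteq> {}"
  obtains f \<alpha> where "minimizes_imbalance f \<alpha>"
proof -
  obtain i where "i \<in> I" using assms by blast
  then have "(\<lambda>l. of_bool (l = i)) \<in> simplex_weights I"
    using finite_indices by (auto simp: simplex_weights_def of_bool_def)
  moreover have "continuous_on (simplex_weights I) (imbalance f)" for f
    unfolding imbalance_def deviation_def
    by (intro continuous_intros continuous_on_subset[OF continuous_on_product_coordinates]) auto
  ultimately have "\<exists>\<alpha>\<in>simplex_weights I. \<forall>\<beta>\<in>simplex_weights I. imbalance f \<alpha> \<le> imbalance f \<beta>" for f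
    using continuous_attains_inf[OF compact_simplex_weights[OF finite_indices]] by blast
  then obtain a where a: "\<And>f. a f \<in> simplex_weights I"
      "\<And>f \<beta>. \<beta> \<in> simplex_weights I \<Longrightarrow> imbalance f (a f) \<le> imbalance f \<beta>" by metis
  have "finite colourings" "colourings \<noteq> {}"
    using finite_indices colour_exists by (auto simp: colourings_def finite_PiE PiE_eq_empty_iff)
  then obtain f where "f \<in> colourings" "\<And>g. g \<in> colourings \<Longrightarrow> imbalance f (a f) \<le> imbalance g (a g)"
    using arg_min_if_finite[of colourings "\<lambda>f. imbalance f (a f)"] by (metis leI)
  with a that show thesis unfolding minimizes_imbalance_def by (meson order_trans)
qed

lemma minimizer_inner_ge:
  assumes "minimizes_imbalance f \<alpha>" "i \<in> I"
  shows "imbalance f \<alpha> \<le> deviation f \<alpha> (f i) \<bullet> y i"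
proof -
  define \<beta> where "\<beta> l = of_bool (l = i) - \<alpha> l" for l
  define slope where "slope = deviation f \<alpha> (f i) \<bullet> y i - imbalance f \<alpha>"
  have f: "f \<in> colourings" and \<alpha>: "\<alpha> \<in> simplex_weights I"
    using assms(1) by (auto simp: minimizes_imbalance_def)
  have "(\<Sum>l\<in>I. \<beta> l * (deviation f \<alpha> (f l) \<bullet> y l)) = slope"
    using assms(2) finite_indices
    by (simp add: \<beta>_def left_diff_distrib sum_subtractf imbalance_eq_weighted_sum[OF f] of_bool_def slope_def
        if_distrib[of "\<lambda>u. u * _"] cong: if_cong)
  note line = imbalance_line[OF f, of \<alpha> _ \<beta>, unfolded this]
  have "0 \<le> 2 * slope + t * imbalance f \<beta>" if t: "0 < t" "t < 1" for t
  proof -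
    have "(\<lambda>l. \<alpha> l + t * \<beta> l) = (\<lambda>l. (1 - t) * \<alpha> l + t * of_bool (l = i))"
      by (auto simp: \<beta>_def algebra_simps)
    moreover have "\<dots> \<in> simplex_weights I"
      using \<alpha> t assms(2) finite_indices
      by (auto simp: simplex_weights_def sum.distrib sum_distrib_left[symmetric] of_bool_def)
    ultimately have "imbalance f \<alpha> \<le> imbalance f (\<lambda>l. \<alpha> l + t * \<beta> l)"
      using assms(1) f by (simp add: minimizes_imbalance_def)
    then have "0 \<le> t * (2 * slope + t * imbalance f \<beta>)"
      by (simp add: line power2_eq_square algebra_simps)
    with t show ?thesis by (simp add: zero_le_mult_iff)
  qed
  then have "0 \<le> 2 * slope" by (rule nonneg_if_nonneg_perturbations)
  then show ?thesis by (simp add: slope_def)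
qed

lemma minimizer_inner_eq:
  assumes "minimizes_imbalance f \<alpha>" "i \<in> I" "0 < \<alpha> i"
  shows "deviation f \<alpha> (f i) \<bullet> y i = imbalance f \<alpha>"
proof -
  let ?excess = "\<lambda>i. \<alpha> i * (deviation f \<alpha> (f i) \<bullet> y i - imbalance f \<alpha>)"
  have f: "f \<in> colourings" and \<alpha>: "\<alpha> \<in> simplex_weights I"
    using assms(1) by (auto simp: minimizes_imbalance_def)
  have "sum ?excess I = 0"
    using \<alpha> by (simp add: right_diff_distrib sum_subtractf sum_distrib_right[symmetric]
        imbalance_eq_weighted_sum[OF f, symmetric] simplex_weights_def)
  moreover have "0 \<le> ?excess i" if "i \<in> I" for i
    using minimizer_inner_ge[OF assms(1) that] \<alpha> that by (auto simp: simplex_weights_def)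
  ultimately have "?excess i = 0"
    using sum_nonneg_eq_0_iff[OF finite_indices, of ?excess] assms(2) by blast
  with assms(3) show ?thesis by simp
qed

text \<open>An index of weight zero may take any colour, and the deviations of all colours sum to zero.\<close>

lemma minimizer_zero_weight_imp_balanced:
  assumes "minimizes_imbalance f \<alpha>" "i \<in> I" "\<alpha> i = 0"
  shows "imbalance f \<alpha> = 0"
proof -
  have f: "f \<in> colourings" using assms(1) by (simp add: minimizes_imbalance_def)
  have "imbalance f \<alpha> \<le> deviation f \<alpha> c \<bullet> y i" if "c < r" for c
  proof -
    have "deviation (f(i := c)) \<alpha> = deviation f \<alpha>"
      unfolding deviation_def using assms(3) by (intro ext sum.cong) auto
    moreover from this have "imbalance (f(i := c)) \<alpha> = imbalance f \<alpha>"
      by (simp add: imbalance_def)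
    moreover have "f(i := c) \<in> colourings"
      using f that assms(2) by (auto simp: colourings_def PiE_iff extensional_def)
    ultimately show ?thesis
      using minimizer_inner_ge[of "f(i := c)" \<alpha> i] assms(1,2) by (simp add: minimizes_imbalance_def)
  qed
  then have "(\<Sum>c<r. imbalance f \<alpha>) \<le> (\<Sum>c<r. deviation f \<alpha> c \<bullet> y i)"
    by (intro sum_mono) auto
  then have "real r * imbalance f \<alpha> \<le> 0"
    using sum_deviation[OF f, of \<alpha>] by (simp add: inner_sum_left[symmetric])
  then show ?thesis
    using colour_exists imbalance_nonneg[of f \<alpha>] by (simp add: mult_le_0_iff)
qed

lemma ex_balanced_relation:
  assumes f: "f \<in> colourings" and large: "(r - 1) * dim (y ` I) < card I"
  obtains \<beta> where "\<exists>i\<in>I. \<beta> i \<noteq> 0" "\<forall>i. i \<notin> I \<longrightarrow> \<beta> i = 0" "\<And>j. j < r \<Longrightarrow> deviation f \<beta> j = 0"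
proof -
  obtain B where B: "finite B" "card B = dim (y ` I)" "y ` I \<subseteq> span B"
    using basis_exists[of "y ` I"] finiteI_independent by metis
  then have equations: "finite ({..<r - 1} \<times> B)" "card ({..<r - 1} \<times> B) < card I"
    using large by (auto simp: card_cartesian_product)
  obtain \<gamma> where \<gamma>: "\<exists>i\<in>I. \<gamma> i \<noteq> 0"
      "\<forall>k\<in>{..<r - 1} \<times> B. (\<Sum>i\<in>I. \<gamma> i * ((of_bool (f i = fst k) - 1 / r) * (y i \<bullet> snd k))) = 0"
    using homogeneous_system_nontrivial_solution[OF equations(1) finite_indices equations(2),
        of "\<lambda>i k. (of_bool (f i = fst k) - 1 / r) * (y i \<bullet> snd k)"] by blast
  define \<beta> where "\<beta> i = (if i \<in> I then \<gamma> i else 0)" for i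
  have zero: "deviation f \<beta> j = 0" if "j < r - 1" for j
  proof -
    have "orthogonal (deviation f \<beta> j) b" if "b \<in> B" for b
      using \<gamma>(2) \<open>j < r - 1\<close> that
      by (auto simp: orthogonal_def deviation_def inner_sum_left \<beta>_def mult.assoc)
    moreover have "deviation f \<beta> j \<in> span B"
      unfolding deviation_def using B(3) by (intro span_sum span_scale) auto
    ultimately show ?thesis
      using orthogonal_to_span orthogonal_self by blast
  qed
  have "(\<Sum>j<Suc (r - 1). deviation f \<beta> j) = 0"
    using sum_deviation[OF f, of \<beta>] colour_exists by simp
  then have "deviation f \<beta> (r - 1) = 0" by (simp add: zero)
  with zero have "deviation f \<beta> j = 0" if "j < r" for j
    using that by (cases "j = r - 1") auto
  moreover have "\<exists>i\<in>I. \<beta> i \<noteq> 0" "\<forall>i. i \<notin> I \<longrightarrow> \<beta> i = 0" using \<gamma>(1) by (auto simp: \<beta>_def)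
  ultimately show thesis using that by blast
qed

theorem ex_balanced_colouring:
  assumes large: "(r - 1) * dim (y ` I) < card I"
  obtains f \<alpha> where "f \<in> colourings" "\<alpha> \<in> simplex_weights I" "\<And>j. j < r \<Longrightarrow> deviation f \<alpha> j = 0"
proof -
  obtain f \<alpha> where minimizer: "minimizes_imbalance f \<alpha>"
    using large ex_imbalance_minimizer by (metis card.empty not_less_zero)
  then have f: "f \<in> colourings" and \<alpha>: "\<alpha> \<in> simplex_weights I" by (auto simp: minimizes_imbalance_def)
  have "imbalance f \<alpha> = 0"
  proof (rule ccontr)
    assume unbalanced: "imbalance f \<alpha> \<noteq> 0"
    then have pos: "0 < \<alpha> i" if "i \<in> I" for i
      using minimizer_zero_weight_imp_balanced[OF minimizer that] \<alpha> that by (force simp: simplex_weights_def)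
    obtain \<beta> where \<beta>: "\<exists>i\<in>I. \<beta> i \<noteq> 0" "\<forall>i. i \<notin> I \<longrightarrow> \<beta> i = 0" "\<And>j. j < r \<Longrightarrow> deviation f \<beta> j = 0"
      using ex_balanced_relation[OF f large] by metis
    have "sum \<beta> I * imbalance f \<alpha> = (\<Sum>i\<in>I. \<beta> i * (deviation f \<alpha> (f i) \<bullet> y i))"
      by (simp add: sum_distrib_right minimizer_inner_eq[OF minimizer] pos)
    also have "\<dots> = 0"
      by (simp add: sum_inner_deviation[OF f sum_deviation[OF f], symmetric] \<beta>(3))
    finally have sum_\<beta>: "sum \<beta> I = 0" using unbalanced by simp
    have "\<exists>i\<in>I. \<beta> i < 0"
      using \<beta>(1) sum_\<beta> sum_nonneg_eq_0_iff[OF finite_indices, of \<beta>] by (meson not_less)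
    then obtain t where t: "\<And>i. i \<in> I \<Longrightarrow> 0 \<le> \<alpha> i + t * \<beta> i" "\<exists>i\<in>I. \<alpha> i + t * \<beta> i = 0"
      using nonneg_line_meets_boundary[OF finite_indices, of \<alpha> \<beta>] less_imp_le[OF pos] by auto
    let ?\<alpha> = "\<lambda>i. \<alpha> i + t * \<beta> i"
    have "?\<alpha> \<in> simplex_weights I"
      using \<alpha> \<beta>(2) t(1) sum_\<beta> by (simp add: simplex_weights_def sum.distrib sum_distrib_left[symmetric])
    moreover have same: "imbalance f ?\<alpha> = imbalance f \<alpha>"
      by (simp add: imbalance_def deviation_line \<beta>(3))
    ultimately have "minimizes_imbalance f ?\<alpha>" using minimizer by (simp add: minimizes_imbalance_def)
    then show False
      using t(2) minimizer_zero_weight_imp_balanced[of f ?\<alpha>] unbalanced same by auto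
  qed
  then have "deviation f \<alpha> j = 0" if "j < r" for j
    using that by (simp add: imbalance_def sum_nonneg_eq_0_iff)
  with f \<alpha> that show thesis by blast
qed

end

lemma partition_on_colour_classes:
  assumes "f ` I \<subseteq> {..<r}" and nonempty: "\<And>j. j < r \<Longrightarrow> {i\<in>I. f i = j} \<noteq> {}"
  defines "P \<equiv> (\<lambda>j. {i\<in>I. f i = j}) ` {..<r}"
  shows "partition_on I P" "card P = r"
proof -
  show "partition_on I P"
    using assms by (fastforce simp: partition_on_def disjoint_def)
  have "inj_on (\<lambda>j. {i\<in>I. f i = j}) {..<r}"
    using nonempty by (intro inj_onI) blast
  then show "card P = r" by (simp add: P_def card_image)
qed

theorem tverberg:
  fixes x :: "'i \<Rightarrow> 'a::euclidean_space"
  assumes "finite I" "0 < r" and large: "(r - 1) * (dim (x ` I) + 1) < card I"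
  obtains P p where "partition_on I P" "card P = r" "\<And>A. A \<in> P \<Longrightarrow> p \<in> convex hull (x ` A)"
proof -
  interpret coloured_vectors "\<lambda>i. (x i, 1 :: real)" I r
    using assms(1,2) by unfold_locales
  have "dim ((\<lambda>i. (x i, 1 :: real)) ` I) \<le> dim (span (x ` I) \<times> (UNIV :: real set))"
    by (intro dim_subset) (auto intro: span_base)
  also have "\<dots> = dim (x ` I) + 1"
    by (subst dim_Times) (auto simp: dim_UNIV)
  finally have "(r - 1) * dim ((\<lambda>i. (x i, 1 :: real)) ` I) < card I"
    using large mult_le_mono2 order_le_less_trans by blast
  then obtain f \<alpha> where f: "f \<in> colourings" and \<alpha>: "\<alpha> \<in> simplex_weights I"
    and balanced: "\<And>j. j < r \<Longrightarrow> deviation f \<alpha> j = 0"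
    using ex_balanced_colouring by metis
  define p where "p = (\<Sum>i\<in>I. \<alpha> i *\<^sub>R x i)"
  let ?class = "\<lambda>j. {i\<in>I. f i = j}"
  have sums: "(\<Sum>i\<in>?class j. \<alpha> i *\<^sub>R x i) = p /\<^sub>R r" "(\<Sum>i\<in>?class j. \<alpha> i) = 1 / r" if "j < r" for j
  proof -
    have "(\<Sum>i\<in>?class j. \<alpha> i *\<^sub>R (x i, 1::real)) = (\<Sum>i\<in>I. \<alpha> i *\<^sub>R (x i, 1::real)) /\<^sub>R r"
      using balanced[OF that] by (simp add: deviation_eq_class_sum_diff)
    then show "(\<Sum>i\<in>?class j. \<alpha> i *\<^sub>R x i) = p /\<^sub>R r" "(\<Sum>i\<in>?class j. \<alpha> i) = 1 / r"
      using \<alpha> by (simp_all add: prod_eq_iff fst_sum snd_sum p_def simplex_weights_def divide_inverse)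
  qed
  have "p \<in> convex hull (x ` ?class j)" if "j < r" for j
  proof -
    have "(\<Sum>i\<in>?class j. (r * \<alpha> i) *\<^sub>R x i) \<in> convex hull (x ` ?class j)"
      using \<alpha> sums(2)[OF that] assms(1,2)
      by (intro convex_sum) (auto simp: sum_distrib_left[symmetric] simplex_weights_def hull_inc)
    also have "(\<Sum>i\<in>?class j. (r * \<alpha> i) *\<^sub>R x i) = p"
      unfolding scaleR_scaleR[symmetric] scaleR_sum_right[symmetric] using sums(1)[OF that] assms(2) by simp
    finally show ?thesis .
  qed
  moreover have "?class j \<noteq> {}" if "j < r" for j
    using sums(2)[OF that] assms(2) by (intro notI) simp
  moreover have "f ` I \<subseteq> {..<r}" using f by (auto simp: colourings_def)
  ultimately show thesis
    using that partition_on_colour_classes[of f I r] by blast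
qed

section \<open>Positive semidefinite matrices\<close>

lemma ex_rayleigh_maximizer:
  fixes f :: "'a::euclidean_space \<Rightarrow> 'a"
  assumes f: "linear f" and V: "subspace V" "\<exists>x\<in>V. x \<noteq> 0"
  obtains v where "v \<in> V" "norm v = 1" "\<And>x. x \<in> V \<Longrightarrow> x \<bullet> f x \<le> (v \<bullet> f v) * (x \<bullet> x)"
proof -
  let ?T = "V \<inter> sphere 0 1"
  obtain x where "x \<in> V" "x \<noteq> 0" using V(2) by auto
  then have "x /\<^sub>R norm x \<in> ?T" using V(1) by (auto simp: subspace_scale)
  moreover have "compact ?T"
    using V(1) by (simp add: closed_Int_compact closed_subspace)
  moreover have "continuous_on ?T (\<lambda>x. x \<bullet> f x)"
    using f by (intro continuous_intros linear_continuous_on) (simp add: linear_conv_bounded_linear)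
  ultimately obtain v where v: "v \<in> ?T" "\<And>x. x \<in> ?T \<Longrightarrow> x \<bullet> f x \<le> v \<bullet> f v"
    using continuous_attains_sup[of ?T "\<lambda>x. x \<bullet> f x"] by blast
  have "x \<bullet> f x \<le> (v \<bullet> f v) * (x \<bullet> x)" if "x \<in> V" for x
  proof (cases "x = 0")
    case False
    then have "x /\<^sub>R norm x \<in> ?T" using V(1) that by (auto simp: subspace_scale)
    from v(2)[OF this] have "(x \<bullet> f x) / (norm x)\<^sup>2 \<le> v \<bullet> f v"
      by (simp add: linear_scale[OF f] power2_eq_square divide_simps)
    then show ?thesis
      using False by (simp add: divide_le_eq power2_norm_eq_inner)
  qed simp
  with v(1) show thesis by (intro that[of v]) auto
qed

lemma self_adjoint_eigenvector:
  fixes f :: "'a::euclidean_space \<Rightarrow> 'a"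
  assumes f: "linear f" "\<And>x y. f x \<bullet> y = x \<bullet> f y"
    and V: "subspace V" "\<And>x. x \<in> V \<Longrightarrow> f x \<in> V" "\<exists>x\<in>V. x \<noteq> 0"
  obtains v l where "v \<in> V" "norm v = 1" "f v = l *\<^sub>R v"
proof -
  obtain v where v: "v \<in> V" "norm v = 1" "\<And>x. x \<in> V \<Longrightarrow> x \<bullet> f x \<le> (v \<bullet> f v) * (x \<bullet> x)"
    using ex_rayleigh_maximizer[OF f(1) V(1,3)] by metis
  define l where "l = v \<bullet> f v"
  define w where "w = f v - l *\<^sub>R v"
  have f_v: "f v = w + l *\<^sub>R v" by (simp add: w_def)
  have "0 \<le> - 2 * (w \<bullet> w) + t * (l * (w \<bullet> w) - w \<bullet> f w)" if "0 < t" for t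
  proof -
    have "v + t *\<^sub>R w \<in> V" using v(1) V by (auto simp: w_def subspace_add subspace_diff subspace_scale)
    moreover have "v \<bullet> v = 1" using v(2) by (simp add: norm_eq_1)
    moreover have "v \<bullet> f w = w \<bullet> w + l * (v \<bullet> w)"
      by (simp add: f(2)[symmetric] f_v inner_simps)
    moreover have "w \<bullet> f v = w \<bullet> w + l * (v \<bullet> w)"
      by (simp add: f_v inner_simps inner_commute)
    ultimately have "0 \<le> t * (- 2 * (w \<bullet> w) + t * (l * (w \<bullet> w) - w \<bullet> f w))"
      using v(3)[of "v + t *\<^sub>R w"]
      by (simp add: linear_add[OF f(1)] linear_scale[OF f(1)] inner_simps l_def[symmetric]
          inner_commute[of w v] algebra_simps)
    with that show ?thesis by (simp add: zero_le_mult_iff)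
  qed
  then have "0 \<le> - 2 * (w \<bullet> w)" by (rule nonneg_if_nonneg_perturbations)
  then have "w = 0" using inner_ge_zero[of w] by (simp add: antisym)
  with v(1,2) show thesis by (intro that[of v l]) (auto simp: f_v)
qed

lemma self_adjoint_eigenvector_orthogonal:
  fixes f :: "'a::euclidean_space \<Rightarrow> 'a"
  assumes f: "linear f" "\<And>x y. f x \<bullet> y = x \<bullet> f y"
    and S: "\<And>s. s \<in> S \<Longrightarrow> \<exists>l. f s = l *\<^sub>R s" "dim S < DIM('a)"
  obtains v l where "norm v = 1" "f v = l *\<^sub>R v" "\<And>s. s \<in> S \<Longrightarrow> orthogonal s v"
proof -
  define V where "V = {x. \<forall>s\<in>S. orthogonal s x}"
  have "subspace V"
    unfolding V_def subspace_def by (auto simp: orthogonal_clauses)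
  moreover have "f x \<in> V" if "x \<in> V" for x
  proof -
    have "s \<bullet> f x = 0" if "s \<in> S" for s
    proof -
      from S(1)[OF that] obtain l where "f s = l *\<^sub>R s" ..
      then show ?thesis
        using f(2)[of s x] \<open>x \<in> V\<close> that by (simp add: V_def orthogonal_def)
    qed
    then show ?thesis by (simp add: V_def orthogonal_def)
  qed
  moreover have "\<exists>x\<in>V. x \<noteq> 0"
  proof -
    obtain x where "x \<noteq> 0" "\<And>y. y \<in> span S \<Longrightarrow> orthogonal x y"
      using orthogonal_to_subspace_exists[OF S(2)] by metis
    then show ?thesis by (intro bexI[of _ x]) (auto simp: V_def orthogonal_commute span_base)
  qed
  ultimately obtain v l where "v \<in> V" "norm v = 1" "f v = l *\<^sub>R v"
    using self_adjoint_eigenvector[OF f] by metis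
  then show thesis using that by (auto simp: V_def)
qed

theorem self_adjoint_orthonormal_eigenbasis:
  fixes f :: "'a::euclidean_space \<Rightarrow> 'a"
  assumes "linear f" "\<And>x y. f x \<bullet> y = x \<bullet> f y"
  obtains S where "finite S" "card S = DIM('a)" "pairwise orthogonal S"
    "\<And>s. s \<in> S \<Longrightarrow> norm s = 1" "\<And>s. s \<in> S \<Longrightarrow> \<exists>l. f s = l *\<^sub>R s"
proof -
  have "\<exists>S. finite S \<and> card S = k \<and> pairwise orthogonal S \<and> (\<forall>s\<in>S. norm s = 1 \<and> (\<exists>l. f s = l *\<^sub>R s))"
    if "k \<le> DIM('a)" for k
    using that
  proof (induction k)
    case 0
    show ?case by (intro exI[of _ "{}"]) auto
  next
    case (Suc k)
    then obtain S where S: "finite S" "card S = k" "pairwise orthogonal S"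
      "\<And>s. s \<in> S \<Longrightarrow> norm s = 1 \<and> (\<exists>l. f s = l *\<^sub>R s)" by auto
    have "dim S < DIM('a)" using dim_le_card'[OF S(1)] S(2) Suc.prems by simp
    then obtain v l where v: "norm v = 1" "f v = l *\<^sub>R v" "\<And>s. s \<in> S \<Longrightarrow> orthogonal s v"
      using self_adjoint_eigenvector_orthogonal[OF assms, of S] S(4) by metis
    have "v \<notin> S" using v(1) v(3)[of v] by (auto simp: orthogonal_self)
    show ?case
    proof (intro exI[of _ "insert v S"] conjI)
      show "pairwise orthogonal (insert v S)"
        using S(3) v(3) by (auto simp: pairwise_insert orthogonal_commute)
    qed (use S v \<open>v \<notin> S\<close> in auto)
  qed
  from this[of "DIM('a)"] that show thesis by auto
qed

definition diagonal_matrix :: "('n \<Rightarrow> real) \<Rightarrow> real^'n^'n" where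
  "diagonal_matrix l = (\<chi> i j. if i = j then l i else 0)"

lemma transpose_diagonal_matrix [simp]: "transpose (diagonal_matrix l) = diagonal_matrix l"
  by (auto simp: diagonal_matrix_def transpose_def vec_eq_iff)

lemma det_diagonal_matrix: "det (diagonal_matrix l) = prod l UNIV"
  by (subst det_diagonal) (auto simp: diagonal_matrix_def)

lemma trace_diagonal_matrix: "trace (diagonal_matrix l) = sum l UNIV"
  by (simp add: trace_def diagonal_matrix_def)

lemma diagonal_matrix_mult_vec: "(diagonal_matrix l *v x) $ i = l i * x $ i"
  by (simp add: diagonal_matrix_def matrix_vector_mult_def if_distrib[of "\<lambda>u. u * _"] cong: if_cong)

lemma diagonal_matrix_mult: "diagonal_matrix l ** diagonal_matrix m = diagonal_matrix (\<lambda>i. l i * m i)"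
  by (simp add: matrix_eq matrix_vector_mul_assoc[symmetric] vec_eq_iff diagonal_matrix_mult_vec)

lemma inner_transpose_matrix_vector:
  fixes A :: "real^'n^'m"
  shows "(transpose A *v x) \<bullet> y = x \<bullet> (A *v y)"
  by (simp add: dot_lmul_matrix)

lemma inner_congruence:
  fixes A :: "real^'n^'n" and P :: "real^'n^'m"
  shows "x \<bullet> ((P ** A ** transpose P) *v y) = (transpose P *v x) \<bullet> (A *v (transpose P *v y))"
  by (metis inner_transpose_matrix_vector matrix_vector_mul_assoc)

theorem symmetric_matrix_diagonalization:
  fixes A :: "real^'n^'n"
  assumes "transpose A = A"
  obtains P l where "orthogonal_matrix P" "A = P ** diagonal_matrix l ** transpose P"
proof -
  have "(A *v x) \<bullet> y = x \<bullet> (A *v y)" for x y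
    using inner_transpose_matrix_vector[of A x y] assms by simp
  then obtain S where S: "finite S" "card S = CARD('n)" "pairwise orthogonal S"
      "\<And>s. s \<in> S \<Longrightarrow> norm s = 1" "\<And>s. s \<in> S \<Longrightarrow> \<exists>l. A *v s = l *\<^sub>R s"
    using self_adjoint_orthonormal_eigenbasis[OF matrix_vector_mul_linear, of A] by auto
  then obtain f where f: "bij_betw f (UNIV :: 'n set) S"
    by (metis finite_class.finite_UNIV finite_same_card_bij)
  then have fS: "f j \<in> S" for j by (auto simp: bij_betw_def)
  with S(5) have "\<forall>j. \<exists>l. A *v f j = l *\<^sub>R f j" by blast
  then obtain l where l: "\<And>j. A *v f j = l j *\<^sub>R f j" by metis
  define P where "P = (\<chi> i j. f j $ i)"
  have "column j P = f j" for j by (simp add: column_def P_def vec_eq_iff)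
  moreover have "orthogonal (f i) (f j)" if "i \<noteq> j" for i j
    using S(3) f fS that by (metis pairwise_def bij_betw_def injD)
  ultimately have P: "orthogonal_matrix P"
    using S(4) fS by (simp add: orthogonal_matrix_orthonormal_columns)
  have "(A ** P) $ i $ j = (P ** diagonal_matrix l) $ i $ j" for i j
  proof -
    have "(A ** P) $ i $ j = (A *v f j) $ i"
      by (simp add: matrix_matrix_mult_def matrix_vector_mult_def P_def)
    also have "\<dots> = (P ** diagonal_matrix l) $ i $ j"
      by (simp add: l matrix_matrix_mult_def diagonal_matrix_def P_def if_distrib[of "\<lambda>u. _ * u"] cong: if_cong)
    finally show ?thesis .
  qed
  then have "A ** P ** transpose P = P ** diagonal_matrix l ** transpose P"
    by (simp add: vec_eq_iff matrix_matrix_mult_def[of _ "transpose P"])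
  then have "A = P ** diagonal_matrix l ** transpose P"
    using P by (simp add: matrix_mul_assoc[symmetric] orthogonal_matrix_def)
  with P that show thesis by blast
qed

definition positive_semidefinite :: "real^'n^'n \<Rightarrow> bool" where
  "positive_semidefinite A \<longleftrightarrow> transpose A = A \<and> (\<forall>x. 0 \<le> x \<bullet> (A *v x))"

lemma positive_semidefinite_combination:
  fixes A B :: "real^'n^'n"
  assumes "positive_semidefinite A" "positive_semidefinite B" "0 \<le> a" "0 \<le> b"
  shows "positive_semidefinite (a *\<^sub>R A + b *\<^sub>R B)"
proof -
  have "transpose (a *\<^sub>R A + b *\<^sub>R B) = a *\<^sub>R transpose A + b *\<^sub>R transpose B"
    by (simp add: transpose_def vec_eq_iff)
  then show ?thesis
    using assms by (simp add: positive_semidefinite_def matrix_vector_mult_add_rdistrib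
        scaleR_matrix_vector_assoc[symmetric] inner_add_right)
qed

lemma positive_semidefinite_congruence:
  assumes "positive_semidefinite A"
  shows "positive_semidefinite (P ** A ** transpose P)"
  unfolding positive_semidefinite_def
proof safe
  show "transpose (P ** A ** transpose P) = P ** A ** transpose P"
    using assms by (simp add: positive_semidefinite_def matrix_transpose_mul matrix_mul_assoc)
  show "0 \<le> x \<bullet> ((P ** A ** transpose P) *v x)" for x
    unfolding inner_congruence using assms by (simp only: positive_semidefinite_def)
qed

lemma positive_semidefinite_diagonal_matrix:
  assumes "\<And>i. 0 \<le> l i"
  shows "positive_semidefinite (diagonal_matrix l)"
  using assms by (simp add: positive_semidefinite_def inner_vec_def diagonal_matrix_mult_vec
      sum_nonneg mult.left_commute)

lemma positive_semidefinite_diagonalization: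
  assumes "positive_semidefinite A"
  obtains P l where "orthogonal_matrix P" "A = P ** diagonal_matrix l ** transpose P" "\<And>i. 0 \<le> l i"
proof -
  obtain P l where P: "orthogonal_matrix P" "A = P ** diagonal_matrix l ** transpose P"
    using assms symmetric_matrix_diagonalization unfolding positive_semidefinite_def by metis
  have "0 \<le> l i" for i
  proof -
    have "transpose P *v (P *v axis i 1) = axis i 1"
      using P(1) by (simp add: matrix_vector_mul_assoc orthogonal_matrix del: transpose_matrix_vector)
    then have "(P *v axis i 1) \<bullet> (A *v (P *v axis i 1)) = axis i 1 \<bullet> (diagonal_matrix l *v axis i 1)"
      unfolding P(2) inner_congruence by simp
    also have "\<dots> = l i" by (simp add: inner_axis' diagonal_matrix_mult_vec)
    finally show ?thesis using assms by (metis positive_semidefinite_def)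
  qed
  with P that show thesis by blast
qed

lemma positive_semidefinite_sqrt:
  fixes A :: "real^'n^'n"
  assumes "positive_semidefinite A"
  obtains R where "positive_semidefinite R" "R ** R = A"
proof -
  obtain P l where P: "orthogonal_matrix P" "A = P ** diagonal_matrix l ** transpose P" "\<And>i. 0 \<le> l i"
    using positive_semidefinite_diagonalization[OF assms] by blast
  let ?D = "diagonal_matrix (\<lambda>i. sqrt (l i))"
  define R where "R = P ** ?D ** transpose P"
  have "R ** R = P ** (?D ** (transpose P ** P) ** ?D) ** transpose P"
    by (simp add: R_def matrix_mul_assoc)
  also have "\<dots> = A"
    using P by (simp add: orthogonal_matrix diagonal_matrix_mult)
  moreover have "positive_semidefinite R"
    unfolding R_def using P(3)
    by (intro positive_semidefinite_congruence positive_semidefinite_diagonal_matrix) simp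
  ultimately show thesis using that by metis
qed

theorem polar_decomposition:
  fixes A :: "real^'n^'n"
  assumes "det A \<noteq> 0"
  obtains R Q where "positive_semidefinite R" "orthogonal_matrix Q" "A = R ** Q"
proof -
  have "A ** transpose A = A ** mat 1 ** transpose A" by simp
  then have "positive_semidefinite (A ** transpose A)"
    by (metis positive_semidefinite_congruence positive_semidefinite_def inner_ge_zero
        matrix_vector_mul_lid transpose_mat)
  then obtain R where R: "positive_semidefinite R" "R ** R = A ** transpose A"
    using positive_semidefinite_sqrt by blast
  then have "det R * det R = det A * det A" by (metis det_mul det_transpose)
  with assms have "det R \<noteq> 0" by auto
  then obtain S where S: "R ** S = mat 1" "S ** R = mat 1"
    unfolding invertible_det_nz[symmetric] invertible_def by blast
  have "transpose S = transpose S ** transpose R ** S"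
    using R(1) S by (simp add: positive_semidefinite_def matrix_mul_assoc[symmetric])
  also have "\<dots> = S"
    using S(1) by (simp add: matrix_transpose_mul[symmetric] transpose_mat)
  finally have "transpose S = S" .
  then have "(S ** A) ** transpose (S ** A) = S ** (R ** R) ** S"
    by (simp add: R(2) matrix_transpose_mul matrix_mul_assoc)
  also have "\<dots> = mat 1" by (metis S matrix_mul_assoc matrix_mul_lid)
  finally have "orthogonal_matrix (S ** A)"
    using matrix_left_right_inverse unfolding orthogonal_matrix_def by blast
  moreover have "A = R ** (S ** A)" by (simp add: matrix_mul_assoc S(1))
  ultimately show thesis using that R(1) by blast
qed

lemma
  fixes A :: "real^'n^'n"
  assumes "positive_semidefinite A"
  shows positive_semidefinite_det_nonneg: "0 \<le> det A"
    and positive_semidefinite_trace_nonneg: "0 \<le> trace A"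
    and positive_semidefinite_det_le_trace: "det A \<le> (trace A / CARD('n)) ^ CARD('n)"
proof -
  let ?n = "CARD('n)"
  obtain P l where P: "orthogonal_matrix P" "A = P ** diagonal_matrix l ** transpose P" "\<And>i. 0 \<le> l i"
    using positive_semidefinite_diagonalization[OF assms] by metis
  have "det P * det P = 1"
    using P(1) det_orthogonal_matrix by fastforce
  then have det: "det A = prod l UNIV"
    by (simp add: P(2) det_mul det_diagonal_matrix)
  then show "0 \<le> det A" using P(3) by (simp add: prod_nonneg)
  have "trace A = trace (transpose P ** (P ** diagonal_matrix l))"
    unfolding P(2) by (rule trace_mul_sym)
  then have trace: "trace A = sum l UNIV"
    using P(1) by (simp add: matrix_mul_assoc orthogonal_matrix trace_diagonal_matrix)
  then show "0 \<le> trace A" using P(3) by (simp add: sum_nonneg)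
  have "prod l UNIV = (prod l UNIV powr (1 / ?n)) ^ ?n"
    using P(3) by (simp add: powr_inverse_root prod_nonneg)
  also have "\<dots> \<le> (\<Sum>i\<in>UNIV. l i / ?n) ^ ?n"
    using arith_geom_mean[of UNIV l] P(3) by (intro power_mono) auto
  finally show "det A \<le> (trace A / ?n) ^ ?n"
    by (simp add: det trace sum_divide_distrib)
qed

lemma positive_semidefinite_quadratic_form_eq_0:
  fixes A :: "real^'n^'n"
  assumes "positive_semidefinite A" "det A \<noteq> 0" "x \<bullet> (A *v x) = 0"
  shows "x = 0"
proof -
  obtain R where R: "positive_semidefinite R" "R ** R = A"
    using positive_semidefinite_sqrt[OF assms(1)] by blast
  then have "(R *v x) \<bullet> (R *v x) = 0"
    using assms(3) by (metis inner_transpose_matrix_vector matrix_vector_mul_assoc positive_semidefinite_def)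
  moreover have "invertible R"
    using assms(2) R(2) by (auto simp: invertible_det_nz det_mul)
  ultimately show ?thesis by (metis inner_eq_zero_iff matrix_left_invertible_ker invertible_def)
qed

lemma det_combination_nonzero:
  fixes A B :: "real^'n^'n"
  assumes A: "positive_semidefinite A" "det A \<noteq> 0" and B: "positive_semidefinite B" "det B \<noteq> 0"
    and ab: "0 \<le> a" "0 \<le> b" "a + b = 1"
  shows "det (a *\<^sub>R A + b *\<^sub>R B) \<noteq> 0"
proof -
  have "x = 0" if "(a *\<^sub>R A + b *\<^sub>R B) *v x = 0" for x
  proof -
    have "a * (x \<bullet> (A *v x)) + b * (x \<bullet> (B *v x)) = x \<bullet> ((a *\<^sub>R A + b *\<^sub>R B) *v x)"
      by (simp add: matrix_vector_mult_add_rdistrib scaleR_matrix_vector_assoc[symmetric] inner_add_right)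
    moreover have "0 \<le> a * (x \<bullet> (A *v x))" "0 \<le> b * (x \<bullet> (B *v x))"
      using A(1) B(1) ab by (auto simp: positive_semidefinite_def)
    ultimately have "a * (x \<bullet> (A *v x)) = 0 \<and> b * (x \<bullet> (B *v x)) = 0"
      unfolding that inner_zero_right by linarith
    moreover have "a \<noteq> 0 \<or> b \<noteq> 0" using ab(3) by auto
    ultimately show "x = 0"
      using positive_semidefinite_quadratic_form_eq_0[OF A, of x]
        positive_semidefinite_quadratic_form_eq_0[OF B, of x] by auto
  qed
  then show ?thesis
    by (metis invertible_det_nz invertible_left_inverse matrix_left_invertible_ker)
qed

lemma det_le_1_if_trace_congruence_le:
  fixes A M :: "real^'n^'n"
  assumes "positive_semidefinite A" and trace: "trace (M ** A ** transpose M) \<le> CARD('n)"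
  shows "(det M)\<^sup>2 * det A \<le> 1"
proof -
  let ?C = "M ** A ** transpose M"
  have psd: "positive_semidefinite ?C" by (rule positive_semidefinite_congruence[OF assms(1)])
  have "(det M)\<^sup>2 * det A = det ?C"
    by (simp add: det_mul power2_eq_square)
  also have "\<dots> \<le> (trace ?C / CARD('n)) ^ CARD('n)"
    by (rule positive_semidefinite_det_le_trace[OF psd])
  also have "\<dots> \<le> 1"
    using trace positive_semidefinite_trace_nonneg[OF psd] by (intro power_le_one) auto
  finally show ?thesis .
qed

lemma positive_semidefinite_congruent_identity:
  fixes S :: "real^'n^'n"
  assumes "positive_semidefinite S" "det S \<noteq> 0"
  obtains M :: "real^'n^'n" where "M ** S ** transpose M = mat 1"
proof -
  obtain R where R: "transpose R = R" "R ** R = S"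
    using positive_semidefinite_sqrt[OF assms(1)] by (metis positive_semidefinite_def)
  then have "det R \<noteq> 0" using assms(2) by (auto simp: det_mul)
  then obtain M where M: "M ** R = mat 1" by (metis invertible_det_nz invertible_def)
  have "M ** S ** transpose M = (M ** R) ** transpose (M ** R)"
    by (simp add: R(1) R(2)[symmetric] matrix_transpose_mul matrix_mul_assoc)
  then show thesis by (intro that[of M]) (simp add: M transpose_mat)
qed

text \<open>A congruence turns the combination into the identity matrix; then one of the two summands has
  trace at most \<open>CARD('n)\<close>, hence determinant at most one.\<close>

lemma min_det_le_det_combination:
  fixes A B :: "real^'n^'n"
  assumes A: "positive_semidefinite A" and B: "positive_semidefinite B"
    and ab: "0 \<le> a" "0 \<le> b" "a + b = 1"
  shows "min (det A) (det B) \<le> det (a *\<^sub>R A + b *\<^sub>R B)"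
proof (cases "det A = 0 \<or> det B = 0")
  case True
  then show ?thesis
    using positive_semidefinite_det_nonneg[OF positive_semidefinite_combination[OF A B ab(1,2)]] by auto
next
  case False
  let ?S = "a *\<^sub>R A + b *\<^sub>R B"
  have "det ?S \<noteq> 0" using False by (intro det_combination_nonzero A B ab) auto
  then obtain M :: "real^'n^'n" where M: "M ** ?S ** transpose M = mat 1"
    using positive_semidefinite_congruent_identity positive_semidefinite_combination[OF A B ab(1,2)]
    by blast
  let ?C = "\<lambda>X. M ** X ** transpose M"
  have "a *\<^sub>R ?C A + b *\<^sub>R ?C B = ?C ?S"
    by (simp add: matrix_eq matrix_vector_mul_assoc[symmetric] matrix_vector_mult_add_rdistrib
        scaleR_matrix_vector_assoc[symmetric] matrix_vector_right_distrib matrix_vector_mult_scaleR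
        del: transpose_matrix_vector)
  then have "trace (a *\<^sub>R ?C A + b *\<^sub>R ?C B) = CARD('n)" by (simp only: M trace_I)
  then have "a * trace (?C A) + b * trace (?C B) = CARD('n)"
    by (simp add: trace_def sum.distrib sum_distrib_left)
  then have "trace (?C A) \<le> CARD('n) \<or> trace (?C B) \<le> CARD('n)"
    using convex_bound_lt[of "- trace (?C A)" "- real CARD('n)" "- trace (?C B)" a b] ab by fastforce
  then have "(det M)\<^sup>2 * det A \<le> 1 \<or> (det M)\<^sup>2 * det B \<le> 1"
    using det_le_1_if_trace_congruence_le[OF A] det_le_1_if_trace_congruence_le[OF B] by auto
  moreover have "(det M)\<^sup>2 * det ?S = 1"
    using arg_cong[OF M, of det] by (simp add: det_mul power2_eq_square mult_ac)
  moreover from this have "0 < (det M)\<^sup>2" by (auto simp: zero_less_power2)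
  ultimately show ?thesis by (metis min_le_iff_disj mult_le_cancel_left_pos)
qed

corollary convex_positive_semidefinite_det_ge:
  "convex {A :: real^'n^'n. positive_semidefinite A \<and> \<kappa> \<le> det A}"
proof (rule convexI)
  fix A B :: "real^'n^'n" and a b :: real
  assume "A \<in> {A. positive_semidefinite A \<and> \<kappa> \<le> det A}" "B \<in> {A. positive_semidefinite A \<and> \<kappa> \<le> det A}"
    and ab: "0 \<le> a" "0 \<le> b" "a + b = 1"
  then show "a *\<^sub>R A + b *\<^sub>R B \<in> {A. positive_semidefinite A \<and> \<kappa> \<le> det A}"
    using positive_semidefinite_combination[of A B a b] min_det_le_det_combination[of A B a b] by auto
qed

section \<open>Volume of affine images\<close>

text \<open>The library fact \<open>measure_linear_image\<close> requires the index type to be of class \<open>wellorder\<close>.\<close>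

definition scales_volume_by_det :: "(real^'n \<Rightarrow> real^'n) \<Rightarrow> bool" where
  "scales_volume_by_det f \<longleftrightarrow> (\<forall>S\<in>lmeasurable. f ` S \<in> lmeasurable \<and>
    measure lebesgue (f ` S) = \<bar>det (matrix f)\<bar> * measure lebesgue S)"

lemma scales_volume_by_det_compose:
  assumes "linear f" "linear g" "scales_volume_by_det f" "scales_volume_by_det g"
  shows "scales_volume_by_det (f \<circ> g)"
  using assms unfolding scales_volume_by_det_def image_comp[symmetric]
  by (simp add: matrix_compose det_mul abs_mult)

lemma scales_volume_by_det_singular:
  fixes f :: "real^'n \<Rightarrow> real^'n"
  assumes "linear f" "\<not> inj f"
  shows "scales_volume_by_det f"
proof -
  have "det (matrix f) = 0" using assms det_nz_iff_inj by blast
  moreover have "negligible (f ` S)" for S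
    using assms negligible_linear_singular_image by blast
  ultimately show ?thesis
    by (simp add: scales_volume_by_det_def negligible_imp_measurable negligible_imp_measure0)
qed

lemma scales_volume_by_det_stretch: "scales_volume_by_det (\<lambda>x. \<chi> i. c i * x $ i)"
proof -
  have "det (matrix (\<lambda>x. \<chi> i. c i * x $ i)) = prod c UNIV"
    by (subst det_diagonal) (auto simp: matrix_def axis_def)
  then show ?thesis
    by (simp add: scales_volume_by_det_def measurable_stretch measure_stretch)
qed

lemma scales_volume_by_det_unimodular:
  fixes f :: "real^'n \<Rightarrow> real^'n"
  assumes "linear f" "\<bar>det (matrix f)\<bar> = 1"
    and "\<And>a b. measure lebesgue (f ` cbox a b) = measure lebesgue (cbox a b)"
  shows "scales_volume_by_det f"
  unfolding scales_volume_by_det_def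
proof
  fix S :: "(real^'n) set"
  assume "S \<in> lmeasurable"
  from measure_linear_sufficient[OF assms(1) this, of 1] assms(3)
  show "f ` S \<in> lmeasurable \<and> measure lebesgue (f ` S) = \<bar>det (matrix f)\<bar> * measure lebesgue S"
    by (simp add: assms(2))
qed

lemma measure_swap_coordinates_cbox:
  fixes a b :: "real^'n"
  shows "measure lebesgue ((\<lambda>x. \<chi> i. x $ Transposition.transpose m n i) ` cbox a b) = measure lebesgue (cbox a b)"
proof -
  let ?\<tau> = "Transposition.transpose m n" and ?h = "\<lambda>x::real^'n. \<chi> i. x $ Transposition.transpose m n i"
  have image: "?h ` cbox a b = cbox (?h a) (?h b)"
  proof (intro equalityI subsetI)
    fix y assume y: "y \<in> cbox (?h a) (?h b)"
    have "a $ i \<le> y $ ?\<tau> i \<and> y $ ?\<tau> i \<le> b $ i" for i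
      using y by (simp add: mem_box_cart) (metis transpose_involutory)
    then have "?h y \<in> cbox a b" by (simp add: mem_box_cart)
    moreover have "y = ?h (?h y)" by (simp add: vec_eq_iff)
    ultimately show "y \<in> ?h ` cbox a b" by blast
  qed (auto simp: mem_box_cart)
  have "(\<Prod>i\<in>UNIV. b $ ?\<tau> i - a $ ?\<tau> i) = (\<Prod>i\<in>UNIV. b $ i - a $ i)"
    by (rule prod.reindex_bij_betw[of ?\<tau> UNIV UNIV "\<lambda>i. b $ i - a $ i"]) simp
  moreover have "cbox (?h a) (?h b) = {} \<longleftrightarrow> cbox a b = {}"
    unfolding image[symmetric] by simp
  ultimately show ?thesis
    unfolding image by (simp add: content_cbox_if_cart)
qed

lemma scales_volume_by_det_swap:
  fixes m n :: "'n::finite"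
  shows "scales_volume_by_det (\<lambda>x::real^'n. \<chi> i. x $ Transposition.transpose m n i)"
    (is "scales_volume_by_det ?h")
proof (rule scales_volume_by_det_unimodular)
  have "matrix ?h = (\<chi> i. (mat 1 :: real^'n^'n) $ Transposition.transpose m n i)"
    by (simp add: matrix_def mat_def axis_def vec_eq_iff)
  then show "\<bar>det (matrix ?h)\<bar> = 1"
    by (simp add: det_permute_rows permutes_swap_id sign_swap_id)
  show "linear ?h" by (intro linearI) (auto simp: vec_eq_iff)
qed (rule measure_swap_coordinates_cbox)

lemma measure_shear_cbox:
  fixes a b :: "real^'n"
  assumes "m \<noteq> n"
  shows "measure lebesgue ((\<lambda>x. \<chi> i. if i = m then x $ m + x $ n else x $ i) ` cbox a b) = measure lebesgue (cbox a b)"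
    (is "measure lebesgue (?h ` _) = _")
proof (cases "cbox a b = {}")
  case False
  define v where "v = axis n (- a $ n)"
  have h: "?h (v + x) = ?h v + ?h x" for x by (simp add: vec_eq_iff)
  have "measure lebesgue (?h ` cbox a b) = measure lebesgue ((+) (?h v) ` ?h ` cbox a b)"
    by (rule measure_translation[symmetric])
  also have "(+) (?h v) ` ?h ` cbox a b = ?h ` (+) v ` cbox a b"
    unfolding image_image h ..
  also have "(+) v ` cbox a b = cbox (v + a) (v + b)" by (simp add: cbox_translation)
  also have "measure lebesgue (?h ` cbox (v + a) (v + b)) = measure lebesgue (cbox (v + a) (v + b))"
    using False assms by (intro measure_shear_interval) (simp_all add: v_def cbox_translation)
  also have "\<dots> = measure lebesgue (cbox a b)"
    unfolding cbox_translation by (rule measure_translation)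
  finally show ?thesis .
qed simp

lemma scales_volume_by_det_shear:
  fixes m n :: "'n::finite"
  assumes "m \<noteq> n"
  shows "scales_volume_by_det (\<lambda>x::real^'n. \<chi> i. if i = m then x $ m + x $ n else x $ i)"
    (is "scales_volume_by_det ?h")
proof (rule scales_volume_by_det_unimodular)
  have "matrix ?h = (\<chi> k. if k = m then row m (mat 1) + 1 *s row n (mat 1) else row k (mat 1))"
    by (auto simp: matrix_def mat_def axis_def vec_eq_iff row_def)
  then show "\<bar>det (matrix ?h)\<bar> = 1"
    using det_row_operation[OF assms, where A = "mat 1 :: real^'n^'n" and c = 1] by simp
  show "linear ?h" by (intro linearI) (auto simp: vec_eq_iff algebra_simps)
qed (rule measure_shear_cbox[OF assms])

lemma scales_volume_by_det_linear:
  fixes f :: "real^'n \<Rightarrow> real^'n"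
  assumes "linear f"
  shows "scales_volume_by_det f"
proof (rule induct_linear_elementary[OF assms])
  fix f :: "real^'n \<Rightarrow> real^'n" and i
  assume f: "linear f" "\<And>x. f x $ i = 0"
  then have "axis i 1 \<notin> range f" by (metis axis_nth rangeE zero_neq_one)
  then have "\<not> inj f" using linear_injective_imp_surjective[OF f(1)] by blast
  with f(1) show "scales_volume_by_det f" by (rule scales_volume_by_det_singular)
qed (fact scales_volume_by_det_compose, fact scales_volume_by_det_stretch,
    rule scales_volume_by_det_swap, fact scales_volume_by_det_shear)

lemma
  fixes A :: "real^'n^'n"
  assumes "S \<in> lmeasurable"
  shows lmeasurable_affine_image: "(\<lambda>y. a + A *v y) ` S \<in> lmeasurable"
    and measure_affine_image: "measure lebesgue ((\<lambda>y. a + A *v y) ` S) = \<bar>det A\<bar> * measure lebesgue S"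
proof -
  have "(\<lambda>y. a + A *v y) ` S = (+) a ` ((*v) A ` S)" by (simp add: image_image)
  then show "(\<lambda>y. a + A *v y) ` S \<in> lmeasurable"
      "measure lebesgue ((\<lambda>y. a + A *v y) ` S) = \<bar>det A\<bar> * measure lebesgue S"
    using scales_volume_by_det_linear[OF matrix_vector_mul_linear, of A] assms
    by (simp_all add: scales_volume_by_det_def measurable_translation measure_translation)
qed

section \<open>Convex sets of finite volume\<close>

lemma convex_imp_lebesgue_measurable:
  fixes S :: "'a::euclidean_space set"
  assumes "convex S"
  shows "S \<in> sets lebesgue"
proof -
  have "S - interior S \<subseteq> frontier S" using closure_subset by (auto simp: frontier_def)
  then have "negligible (S - interior S)"
    using negligible_convex_frontier[OF assms] negligible_subset by blast
  then have "interior S \<union> (S - interior S) \<in> sets lebesgue"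
    by (intro sets.Un) (auto simp: negligible_imp_sets)
  then show ?thesis using interior_subset[of S] by (simp add: Un_absorb1)
qed

lemma ball_subset_convex_shrink:
  fixes S :: "'a::real_normed_vector set"
  assumes "convex S" "ball z \<rho> \<subseteq> S" "x \<in> S" "0 \<le> s" "s < 1"
  shows "ball (z + s *\<^sub>R (x - z)) ((1 - s) * \<rho>) \<subseteq> S"
proof
  fix p assume p: "p \<in> ball (z + s *\<^sub>R (x - z)) ((1 - s) * \<rho>)"
  define h where "h = p - (z + s *\<^sub>R (x - z))"
  have "norm h < (1 - s) * \<rho>"
    using p by (simp add: h_def dist_norm norm_minus_commute)
  then have "z + h /\<^sub>R (1 - s) \<in> ball z \<rho>"
    using assms(5) by (simp add: dist_norm pos_divide_less_eq mult.commute flip: divide_inverse)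
  then have "z + h /\<^sub>R (1 - s) \<in> S" using assms(2) by (rule subsetD[rotated])
  then have "(1 - s) *\<^sub>R (z + h /\<^sub>R (1 - s)) + s *\<^sub>R x \<in> S"
    using assms(1,3-5) by (intro convexD) simp_all
  also have "(1 - s) *\<^sub>R (z + h /\<^sub>R (1 - s)) + s *\<^sub>R x = p"
    using assms(5) by (simp add: scaleR_add_right) (simp add: h_def algebra_simps)
  finally show "p \<in> S" .
qed

lemma measure_evenly_spaced_balls:
  fixes u z :: "'a::euclidean_space"
  assumes "norm u = 1" "0 < \<rho>"
  shows "measure lebesgue (\<Union>k<N. ball (z + (2 * \<rho> * real k) *\<^sub>R u) \<rho>) = N * measure lebesgue (ball z \<rho>)"
proof -
  define c where "c k = z + (2 * \<rho> * real k) *\<^sub>R u" for k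
  have "2 * \<rho> \<le> dist (c j) (c k)" if "j \<noteq> k" for j k
  proof -
    have "c j - c k = (2 * \<rho> * (real j - real k)) *\<^sub>R u" by (simp add: c_def algebra_simps)
    then have "dist (c j) (c k) = 2 * \<rho> * \<bar>real j - real k\<bar>"
      using assms by (simp add: dist_norm abs_mult)
    moreover have "1 \<le> \<bar>real j - real k\<bar>" using that by linarith
    ultimately show ?thesis using assms(2) by simp
  qed
  then have "pairwise (\<lambda>j k. disjnt (ball (c j) \<rho>) (ball (c k) \<rho>)) {..<N}"
    by (auto simp: pairwise_def disjnt_def intro!: disjoint_ballI)
  then have "measure lebesgue (\<Union>k<N. ball (c k) \<rho>) = (\<Sum>k<N. measure lebesgue (ball (c k) \<rho>))"
    by (intro measure_UNION') auto
  then show ?thesis using assms(2) by (simp add: c_def content_ball)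
qed

lemma convex_positive_measure_imp_interior_nonempty:
  fixes S :: "'a::euclidean_space set"
  assumes "convex S" "0 < measure lebesgue S"
  shows "interior S \<noteq> {}"
  using assms negligible_convex_interior negligible_imp_measure0 by fastforce

text \<open>The cone over a ball with a distant apex contains many disjoint balls of half the radius, centred
  on its axis.\<close>

lemma convex_finite_measure_imp_bounded:
  fixes S :: "'a::euclidean_space set"
  assumes "convex S" "interior S \<noteq> {}" "S \<in> lmeasurable"
  shows "bounded S"
proof (rule ccontr)
  assume "\<not> bounded S"
  obtain z e where "0 < e" "ball z e \<subseteq> S" using assms(2) by (metis ex_in_conv mem_interior)
  then obtain \<rho> where \<rho>: "0 < \<rho>" "ball z (2 * \<rho>) \<subseteq> S" by (metis half_gt_zero field_sum_of_halves mult_2)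
  then have "0 < measure lebesgue (ball z \<rho>)" by (simp add: content_ball)
  then obtain N :: nat where N: "measure lebesgue S < N * measure lebesgue (ball z \<rho>)"
    using reals_Archimedean3 by blast
  obtain x where x: "x \<in> S" "norm x > norm z + 4 * \<rho> * N"
    using \<open>\<not> bounded S\<close> by (auto simp: bounded_iff not_le)
  define L where "L = norm (x - z)"
  define u where "u = (x - z) /\<^sub>R L"
  have far: "4 * \<rho> * N < L" using x(2) norm_triangle_ineq2[of x z] by (simp add: L_def)
  then have "0 < L" using \<rho>(1) by (smt (verit) mult_nonneg_nonneg of_nat_0_le_iff)
  have "ball (z + (2 * \<rho> * real k) *\<^sub>R u) \<rho> \<subseteq> S" if "k < N" for k
  proof -
    define s where "s = 2 * \<rho> * k / L"
    have "4 * \<rho> * k \<le> 4 * \<rho> * N" using that \<rho>(1) by simp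
    with far have "4 * \<rho> * k \<le> L" by linarith
    then have s: "0 \<le> s" "s \<le> 1 / 2" using \<open>0 < L\<close> \<rho>(1) by (simp_all add: s_def field_simps)
    have "ball (z + s *\<^sub>R (x - z)) \<rho> \<subseteq> ball (z + s *\<^sub>R (x - z)) ((1 - s) * (2 * \<rho>))"
      using \<rho>(1) mult_right_mono[OF s(2), of "2 * \<rho>"] by (intro subset_ball) (simp add: algebra_simps)
    also have "\<dots> \<subseteq> S"
      using assms(1) \<rho>(2) x(1) s by (intro ball_subset_convex_shrink) auto
    finally show ?thesis by (simp add: s_def u_def divide_inverse)
  qed
  then have "measure lebesgue (\<Union>k<N. ball (z + (2 * \<rho> * real k) *\<^sub>R u) \<rho>) \<le> measure lebesgue S"
    using assms(3) by (intro measure_mono_fmeasurable) auto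
  moreover have "norm u = 1" using \<open>0 < L\<close> by (simp add: u_def L_def)
  ultimately show False using N measure_evenly_spaced_balls[OF _ \<rho>(1), of u z N] by linarith
qed

lemma compact_convex_subset_measure_ge:
  fixes C :: "'a::euclidean_space set"
  assumes C: "convex C" "closed C" and v: "0 < v" "ennreal v \<le> emeasure lebesgue C"
  obtains K where "compact K" "convex K" "K \<subseteq> C" "v \<le> measure lebesgue K"
proof (cases "emeasure lebesgue C = \<infinity>")
  case True
  define K where "K n = C \<inter> cball 0 (real n)" for n
  have K: "compact (K n)" "convex (K n)" "K n \<subseteq> C" for n
    using C by (auto simp: K_def closed_Int_compact convex_Int)
  have "incseq K" by (auto simp: incseq_def K_def)
  moreover have "range K \<subseteq> sets lebesgue"
    using K(2) convex_imp_lebesgue_measurable by blast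
  moreover have "(\<Union>n. K n) = C" by (auto simp: K_def real_arch_simple)
  ultimately have "(SUP n. emeasure lebesgue (K n)) = \<infinity>"
    using SUP_emeasure_incseq[of K lebesgue] True by simp
  then have "ennreal v < (SUP n. emeasure lebesgue (K n))"
    by (metis ennreal_less_top infinity_ennreal_def)
  then obtain n where "ennreal v < emeasure lebesgue (K n)" by (auto simp: less_SUP_iff)
  then have "v \<le> measure lebesgue (K n)"
    using v(1) by (simp add: emeasure_eq_measure2 lmeasurable_compact K(1) ennreal_less_iff)
  then show ?thesis using that[of "K n"] K by auto
next
  case False
  then have lm: "C \<in> lmeasurable"
    using convex_imp_lebesgue_measurable[OF C(1)] by (intro fmeasurableI) (auto simp: top.not_eq_extremum)
  then have vol: "v \<le> measure lebesgue C"
    using v(2) by (simp add: emeasure_eq_measure2)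
  then have "interior C \<noteq> {}"
    using v(1) by (intro convex_positive_measure_imp_interior_nonempty C(1)) simp
  then have "compact C"
    using convex_finite_measure_imp_bounded[OF C(1) _ lm] C(2) by (simp add: compact_eq_bounded_closed)
  then show ?thesis using that C(1) vol by blast
qed

section \<open>Ellipsoids in convex bodies\<close>

definition ellipsoid :: "real^'n^'n \<Rightarrow> real^'n \<Rightarrow> (real^'n) set" where
  "ellipsoid A a = (\<lambda>y. a + A *v y) ` cball 0 1"

lemma lmeasurable_ellipsoid: "ellipsoid A a \<in> lmeasurable"
  unfolding ellipsoid_def by (rule lmeasurable_affine_image) simp

lemma measure_ellipsoid:
  fixes A :: "real^'n^'n"
  shows "measure lebesgue (ellipsoid A a) = \<bar>det A\<bar> * unit_ball_vol (CARD('n))"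
  unfolding ellipsoid_def by (subst measure_affine_image) (simp_all add: content_cball)

lemma convex_ellipsoid: "convex (ellipsoid A a)"
proof -
  have "ellipsoid A a = (+) a ` ((*v) A ` cball 0 1)" by (simp add: ellipsoid_def image_image)
  then show ?thesis
    by (simp add: convex_translation_eq convex_linear_image)
qed

lemma bounded_ellipsoid: "bounded (ellipsoid A a)"
proof -
  have "compact ((\<lambda>y. a + A *v y) ` cball 0 1)"
    by (intro compact_continuous_image continuous_intros compact_cball)
  then show ?thesis by (simp add: ellipsoid_def compact_imp_bounded)
qed

lemma ellipsoid_matrix_mult: "ellipsoid (A ** B) (a + A *v b) = (\<lambda>z. a + A *v z) ` ellipsoid B b"
  by (simp add: ellipsoid_def image_image matrix_vector_right_distrib matrix_vector_mul_assoc add.assoc)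

lemma ellipsoid_matrix_mult_orthogonal:
  assumes "orthogonal_matrix Q"
  shows "ellipsoid (A ** Q) a = ellipsoid A a"
proof -
  have "orthogonal_transformation ((*v) Q)"
    using assms by (simp add: orthogonal_transformation_matrix)
  from image_orthogonal_transformation_cball[OF this, of 0 1]
  have "(\<lambda>z. a + A *v z) ` (*v) Q ` cball 0 1 = (\<lambda>z. a + A *v z) ` cball 0 1" by simp
  then show ?thesis
    by (simp add: ellipsoid_def image_image matrix_vector_mul_assoc)
qed

lemma mem_ellipsoid_scaleR:
  assumes "norm y \<le> \<rho>" "0 < \<rho>"
  shows "a + A *v y \<in> ellipsoid (\<rho> *\<^sub>R A) a"
proof -
  have "a + A *v y = a + (\<rho> *\<^sub>R A) *v (y /\<^sub>R \<rho>)"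
    using assms by (simp add: scaleR_matrix_vector_assoc[symmetric] matrix_vector_mult_scaleR)
  moreover have "y /\<^sub>R \<rho> \<in> cball 0 1" using assms by (simp add: field_simps)
  ultimately show ?thesis unfolding ellipsoid_def by blast
qed

lemma ellipsoid_scaled_identity:
  fixes z :: "real^'n"
  assumes "0 < \<rho>"
  shows "ellipsoid (matrix ((*\<^sub>R) \<rho>)) z = cball z \<rho>"
proof -
  have "ellipsoid (matrix ((*\<^sub>R) \<rho>)) z = (+) z ` ((*\<^sub>R) \<rho> ` cball 0 1)"
    by (simp add: ellipsoid_def image_image matrix_works linear_scaleR)
  then show ?thesis using assms by (simp add: cball_scale)
qed

lemma convex_inscribed_ellipsoids:
  fixes C :: "(real^'n) set"
  assumes "convex C"
  shows "convex {(A, a). ellipsoid A a \<subseteq> C}"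
proof (rule convexI)
  fix g h :: "(real^'n^'n) \<times> (real^'n)" and u v :: real
  assume "g \<in> {(A, a). ellipsoid A a \<subseteq> C}" "h \<in> {(A, a). ellipsoid A a \<subseteq> C}"
    and uv: "0 \<le> u" "0 \<le> v" "u + v = 1"
  then obtain A a B b where gh: "g = (A, a)" "h = (B, b)" and sub: "ellipsoid A a \<subseteq> C" "ellipsoid B b \<subseteq> C"
    by (cases g, cases h) auto
  have "(u *\<^sub>R a + v *\<^sub>R b) + (u *\<^sub>R A + v *\<^sub>R B) *v y \<in> C" if "norm y \<le> 1" for y
  proof -
    have "u *\<^sub>R (a + A *v y) + v *\<^sub>R (b + B *v y) \<in> C"
      using sub that uv by (intro convexD assms) (auto simp: ellipsoid_def)
    then show ?thesis
      by (simp add: matrix_vector_mult_add_rdistrib scaleR_matrix_vector_assoc[symmetric] algebra_simps)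
  qed
  then show "u *\<^sub>R g + v *\<^sub>R h \<in> {(A, a). ellipsoid A a \<subseteq> C}"
    by (auto simp: gh ellipsoid_def)
qed

lemma norm_matrix_le_sum_abs: "norm A \<le> (\<Sum>i\<in>UNIV. \<Sum>j\<in>UNIV. \<bar>A $ i $ j\<bar>)"
  for A :: "real^'n^'m"
proof -
  have "norm A \<le> (\<Sum>i\<in>UNIV. norm (A $ i))"
    unfolding norm_vec_def[of A] by (simp add: L2_set_le_sum)
  also have "\<dots> \<le> (\<Sum>i\<in>UNIV. \<Sum>j\<in>UNIV. \<bar>A $ i $ j\<bar>)"
    by (intro sum_mono norm_le_l1_cart)
  finally show ?thesis .
qed

lemma norm_le_if_ellipsoid_subset_cball:
  fixes A :: "real^'n^'n"
  assumes "ellipsoid A a \<subseteq> cball 0 R"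
  shows "norm a \<le> R" and "norm A \<le> real CARD('n) * (real CARD('n) * (2 * R))"
proof -
  have bound: "norm (a + A *v y) \<le> R" if "norm y \<le> 1" for y
    using assms that by (force simp: ellipsoid_def)
  show a: "norm a \<le> R" using bound[of 0] by simp
  have "\<bar>A $ i $ j\<bar> \<le> 2 * R" for i j
  proof -
    have "\<bar>A $ i $ j\<bar> \<le> norm (A *v axis j 1)"
      using component_le_norm_cart[of "A *v axis j 1" i] by (simp add: matrix_vector_mult_basis column_def)
    also have "\<dots> \<le> norm (a + A *v axis j 1) + norm a"
      using norm_triangle_ineq4[of "a + A *v axis j 1" a] by simp
    also have "\<dots> \<le> 2 * R" using bound[of "axis j 1"] a by (simp add: norm_axis_1)
    finally show ?thesis .
  qed
  then have "(\<Sum>i\<in>UNIV. \<Sum>j\<in>UNIV. \<bar>A $ i $ j\<bar>) \<le> (\<Sum>i\<in>(UNIV :: 'n set). \<Sum>j\<in>(UNIV :: 'n set). 2 * R)"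
    by (intro sum_mono)
  with norm_matrix_le_sum_abs[of A] show "norm A \<le> real CARD('n) * (real CARD('n) * (2 * R))" by simp
qed

lemma compact_inscribed_ellipsoids:
  fixes K :: "(real^'n) set"
  assumes "compact K"
  shows "compact {(A, a). ellipsoid A a \<subseteq> K}" (is "compact ?G")
  unfolding compact_eq_bounded_closed
proof
  obtain R where "K \<subseteq> cball 0 R"
    using compact_imp_bounded[OF assms] by (auto simp: bounded_iff subset_iff)
  then have "norm (A, a) \<le> real CARD('n) * (real CARD('n) * (2 * R)) + R" if "(A, a) \<in> ?G" for A a
    using that norm_le_if_ellipsoid_subset_cball[of A a R] norm_Pair_le[of A a] by fastforce
  then show "bounded ?G" unfolding bounded_iff by (metis surj_pair)
  have "continuous_on UNIV (\<lambda>g :: (real^'n^'n) \<times> (real^'n). snd g + fst g *v y)" for y :: "real^'n"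
    by (intro linear_continuous_on linear_conv_bounded_linear[THEN iffD1] linearI)
      (auto simp: matrix_vector_mult_add_rdistrib scaleR_matrix_vector_assoc algebra_simps)
  then have "closed ((\<lambda>g :: (real^'n^'n) \<times> (real^'n). snd g + fst g *v y) -` K)" for y :: "real^'n"
    by (rule closed_vimage[OF compact_imp_closed[OF assms]])
  moreover have "?G = (\<Inter>y\<in>cball 0 1. (\<lambda>g. snd g + fst g *v y) -` K)"
    by (auto simp: ellipsoid_def)
  ultimately show "closed ?G" by (simp add: closed_INT)
qed

lemma ex_maximal_inscribed_ellipsoid:
  fixes K :: "(real^'n) set"
  assumes "compact K" "interior K \<noteq> {}"
  obtains A a where "ellipsoid A a \<subseteq> K" "det A \<noteq> 0"
    "\<And>B b. ellipsoid B b \<subseteq> K \<Longrightarrow> \<bar>det B\<bar> \<le> \<bar>det A\<bar>"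
proof -
  let ?G = "{(A, a). ellipsoid A a \<subseteq> K}"
  obtain z \<rho> where z: "0 < \<rho>" "cball z \<rho> \<subseteq> K"
    using assms(2) by (metis ex_in_conv mem_interior_cball)
  then have ball: "(matrix ((*\<^sub>R) \<rho>), z) \<in> ?G" by (simp add: ellipsoid_scaled_identity)
  have cont: "continuous_on ?G (\<lambda>g. \<bar>det (fst g)\<bar>)"
    unfolding det_def by (intro continuous_intros)
  then obtain g where g: "g \<in> ?G" "\<And>h. h \<in> ?G \<Longrightarrow> \<bar>det (fst h)\<bar> \<le> \<bar>det (fst g)\<bar>"
    using continuous_attains_sup[OF compact_inscribed_ellipsoids[OF assms(1)] _ cont] ball by blast
  have "\<rho> ^ CARD('n) \<le> \<bar>det (fst g)\<bar>" using g(2)[OF ball] z(1) by simp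
  then have "det (fst g) \<noteq> 0" using z(1) by (metis abs_zero not_le zero_less_power)
  moreover have "ellipsoid (fst g) (snd g) \<subseteq> K" using g(1) by (simp add: case_prod_unfold)
  moreover have "\<bar>det B\<bar> \<le> \<bar>det (fst g)\<bar>" if "ellipsoid B b \<subseteq> K" for B b
    using g(2)[of "(B, b)"] that by simp
  ultimately show thesis using that by blast
qed

lemma stretched_support_bound:
  fixes s \<nu> t \<epsilon> :: real
  assumes "\<bar>s\<bar> \<le> \<nu>" "1 < t" "0 \<le> \<epsilon>" "2 * \<epsilon> \<le> t - 1"
  defines "\<beta> \<equiv> 1 - 2 * \<epsilon> / (t - 1)"
  shows "\<epsilon> * s + sqrt (\<beta> * \<nu>\<^sup>2 + ((1 + \<epsilon>)\<^sup>2 - \<beta>) * s\<^sup>2) \<le> max \<nu> (t * s)"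
proof -
  define m where "m = max \<nu> (t * s)"
  define c where "c = \<epsilon> / (t - 1)"
  have c: "\<epsilon> = c * (t - 1)" "\<beta> = 1 - 2 * c" "0 \<le> c" "0 \<le> \<beta>"
    using assms(2-4) by (auto simp: c_def \<beta>_def)
  have m: "\<nu> \<le> m" "t * s \<le> m" by (auto simp: m_def)
  have "\<beta> * \<nu>\<^sup>2 \<le> \<beta> * m\<^sup>2"
    using m(1) assms(1) c(4) by (intro mult_left_mono power_mono) auto
  moreover have "0 \<le> 2 * c * ((m - t * s) * (m + s))"
    using m assms(1) c(3) by (intro mult_nonneg_nonneg) auto
  moreover have "2 * c * ((m - t * s) * (m + s)) = (m - \<epsilon> * s)\<^sup>2 - (\<beta> * m\<^sup>2 + ((1 + \<epsilon>)\<^sup>2 - \<beta>) * s\<^sup>2)"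
    unfolding c(1,2) by (simp add: power2_eq_square algebra_simps)
  ultimately have "\<beta> * \<nu>\<^sup>2 + ((1 + \<epsilon>)\<^sup>2 - \<beta>) * s\<^sup>2 \<le> (m - \<epsilon> * s)\<^sup>2" by linarith
  moreover have "\<epsilon> * s \<le> m"
  proof (cases "0 \<le> s")
    case True
    then have "\<epsilon> * s \<le> t * s" using assms(2-4) by (intro mult_right_mono) auto
    with m(2) show ?thesis by linarith
  next
    case False
    then have "\<epsilon> * s \<le> 0" using assms(3) by (simp add: mult_nonneg_nonpos)
    with m(1) assms(1) show ?thesis by linarith
  qed
  ultimately have "sqrt (\<beta> * \<nu>\<^sup>2 + ((1 + \<epsilon>)\<^sup>2 - \<beta>) * s\<^sup>2) \<le> m - \<epsilon> * s"
    by (intro real_le_lsqrt) auto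
  then show ?thesis by (simp add: m_def)
qed

lemma mem_closed_convex_if_support_le:
  fixes K :: "'a::euclidean_space set"
  assumes "convex K" "closed K" "\<And>n. \<exists>z\<in>K. n \<bullet> p \<le> n \<bullet> z"
  shows "p \<in> K"
proof (rule ccontr)
  assume "p \<notin> K"
  then obtain u \<beta> where "u \<bullet> p < \<beta>" "\<And>z. z \<in> K \<Longrightarrow> \<beta> < u \<bullet> z"
    using separating_hyperplane_closed_point[OF assms(1,2)] by metis
  then show False using assms(3)[of "- u"] by force
qed

definition stretch_matrix :: "'n \<Rightarrow> real \<Rightarrow> real \<Rightarrow> real^'n^'n" where
  "stretch_matrix k t \<epsilon> = diagonal_matrix (\<lambda>i. if i = k then 1 + \<epsilon> else sqrt (1 - 2 * \<epsilon> / (t - 1)))"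

lemma det_stretch_matrix:
  "det (stretch_matrix k t \<epsilon> :: real^'n^'n) = (1 + \<epsilon>) * sqrt (1 - 2 * \<epsilon> / (t - 1)) ^ (CARD('n) - 1)"
proof -
  let ?l = "\<lambda>i. if i = k then 1 + \<epsilon> else sqrt (1 - 2 * \<epsilon> / (t - 1))"
  have "prod ?l UNIV = ?l k * prod ?l (UNIV - {k})" by (rule prod.remove) auto
  then show ?thesis by (simp add: stretch_matrix_def det_diagonal_matrix card_Diff_singleton)
qed

lemma norm_stretch_matrix_mult_vec:
  fixes x :: "real^'n"
  assumes "1 < t" "2 * \<epsilon> \<le> t - 1"
  defines "\<beta> \<equiv> 1 - 2 * \<epsilon> / (t - 1)"
  shows "norm (stretch_matrix k t \<epsilon> *v x) = sqrt (\<beta> * (norm x)\<^sup>2 + ((1 + \<epsilon>)\<^sup>2 - \<beta>) * (x $ k)\<^sup>2)"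
proof -
  have "0 \<le> \<beta>" using assms(1,2) by (simp add: \<beta>_def)
  then have "(stretch_matrix k t \<epsilon> *v x) \<bullet> (stretch_matrix k t \<epsilon> *v x) =
      (\<Sum>i\<in>UNIV. \<beta> * (x $ i)\<^sup>2 + (if i = k then ((1 + \<epsilon>)\<^sup>2 - \<beta>) * (x $ i)\<^sup>2 else 0))"
    unfolding inner_vec_def stretch_matrix_def \<beta>_def[symmetric]
    by (intro sum.cong) (auto simp: diagonal_matrix_mult_vec power2_eq_square algebra_simps)
  also have "\<dots> = \<beta> * (norm x)\<^sup>2 + ((1 + \<epsilon>)\<^sup>2 - \<beta>) * (x $ k)\<^sup>2"
    unfolding power2_norm_eq_inner
    by (simp add: sum.distrib sum_distrib_left[symmetric] inner_vec_def power2_eq_square)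
  finally show ?thesis by (simp add: norm_eq_sqrt_inner)
qed

text \<open>The stretched ball touches the unit ball at \<open>- axis k 1\<close>, and its semi-axes orthogonal to \<open>axis k 1\<close>
  are as large as the cone over the unit ball with apex \<open>t *\<^sub>R axis k 1\<close> permits.\<close>

lemma stretched_ball_subset:
  fixes K :: "(real^'n) set"
  assumes K: "convex K" "closed K" "cball 0 1 \<subseteq> K" "t *\<^sub>R axis k 1 \<in> K"
    and "1 < t" "0 \<le> \<epsilon>" "2 * \<epsilon> \<le> t - 1"
  shows "ellipsoid (stretch_matrix k t \<epsilon>) (\<epsilon> *\<^sub>R axis k 1) \<subseteq> K"
proof
  fix p assume "p \<in> ellipsoid (stretch_matrix k t \<epsilon>) (\<epsilon> *\<^sub>R axis k 1)"
  then obtain y where y: "norm y \<le> 1" "p = \<epsilon> *\<^sub>R axis k 1 + stretch_matrix k t \<epsilon> *v y"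
    by (auto simp: ellipsoid_def)
  show "p \<in> K"
  proof (rule mem_closed_convex_if_support_le[OF K(1,2)])
    fix n :: "real^'n"
    have "n \<bullet> (stretch_matrix k t \<epsilon> *v y) = (stretch_matrix k t \<epsilon> *v n) \<bullet> y"
      using inner_transpose_matrix_vector[of "stretch_matrix k t \<epsilon>" n y] by (simp add: stretch_matrix_def)
    also have "\<dots> \<le> norm (stretch_matrix k t \<epsilon> *v n) * norm y" by (rule norm_cauchy_schwarz)
    also have "\<dots> \<le> norm (stretch_matrix k t \<epsilon> *v n)" using y(1) by (simp add: mult_left_le)
    finally have "n \<bullet> p \<le> \<epsilon> * n $ k + norm (stretch_matrix k t \<epsilon> *v n)"
      by (simp add: y(2) inner_simps inner_axis)
    also have "\<dots> \<le> max (norm n) (t * n $ k)"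
      using assms(5-7) component_le_norm_cart[of n k]
      by (simp add: norm_stretch_matrix_mult_vec stretched_support_bound)
    finally have "n \<bullet> p \<le> norm n \<or> n \<bullet> p \<le> n \<bullet> (t *\<^sub>R axis k 1)"
      by (auto simp: inner_axis le_max_iff_disj)
    moreover have "norm n = n \<bullet> sgn n"
      by (simp add: sgn_div_norm norm_eq_sqrt_inner real_div_sqrt flip: divide_inverse_commute)
    moreover have "sgn n \<in> K" using K(3) by (auto simp: norm_sgn)
    ultimately show "\<exists>z\<in>K. n \<bullet> p \<le> n \<bullet> z" using K(4) by metis
  qed
qed

lemma enlarged_ellipsoid:
  fixes K :: "(real^'n) set"
  assumes K: "convex K" "closed K" "ellipsoid A a \<subseteq> K" and y: "a + A *v y \<in> K" "norm y = t"
    and \<epsilon>: "1 < t" "0 \<le> \<epsilon>" "2 * \<epsilon> \<le> t - 1"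
  obtains M c where "ellipsoid M c \<subseteq> K"
    "\<bar>det M\<bar> = \<bar>det A\<bar> * ((1 + \<epsilon>) * sqrt (1 - 2 * \<epsilon> / (t - 1)) ^ (CARD('n) - 1))"
proof -
  fix k :: 'n
  obtain Q where Q: "orthogonal_matrix Q" "Q *v axis k 1 = y /\<^sub>R t"
    using orthogonal_matrix_exists_basis[of "y /\<^sub>R t" k] y(2) \<epsilon>(1) by auto
  define L where "L = (\<lambda>z. a + (A ** Q) *v z) -` K"
  have "closed L" unfolding L_def
    by (intro continuous_closed_vimage K(2) continuous_intros)
  moreover have "L = (*v) (A ** Q) -` ((+) (- a) ` K)"
    by (auto simp: L_def image_iff) (metis add.commute add_diff_cancel_left' diff_conv_add_uminus)
  then have "convex L"
    using K(1) by (simp add: convex_linear_vimage convex_translation)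
  moreover have "cball 0 1 \<subseteq> L"
    using K(3) unfolding ellipsoid_matrix_mult_orthogonal[OF Q(1), of A a, symmetric]
    by (auto simp: L_def ellipsoid_def)
  moreover have "(A ** Q) *v (t *\<^sub>R axis k 1) = A *v y"
    using Q(2) \<epsilon>(1) by (simp add: matrix_vector_mul_assoc[symmetric] matrix_vector_mult_scaleR)
  then have "t *\<^sub>R axis k 1 \<in> L" using y(1) by (simp add: L_def)
  ultimately have "ellipsoid (stretch_matrix k t \<epsilon>) (\<epsilon> *\<^sub>R axis k 1) \<subseteq> L"
    using \<epsilon> by (intro stretched_ball_subset)
  then have "ellipsoid ((A ** Q) ** stretch_matrix k t \<epsilon>) (a + (A ** Q) *v (\<epsilon> *\<^sub>R axis k 1)) \<subseteq> K"
    unfolding ellipsoid_matrix_mult L_def by blast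
  moreover have "\<bar>det ((A ** Q) ** stretch_matrix k t \<epsilon>)\<bar> =
      \<bar>det A\<bar> * ((1 + \<epsilon>) * sqrt (1 - 2 * \<epsilon> / (t - 1)) ^ (CARD('n) - 1))"
    using det_orthogonal_matrix[OF Q(1)] \<epsilon> by (auto simp: det_mul abs_mult det_stretch_matrix power_abs)
  ultimately show thesis using that by blast
qed

lemma ex_volume_increasing_stretch:
  fixes t :: real
  assumes "real d < t" "1 \<le> d"
  obtains \<epsilon> where "0 < \<epsilon>" "2 * \<epsilon> \<le> t - 1" "1 < (1 + \<epsilon>) * sqrt (1 - 2 * \<epsilon> / (t - 1)) ^ (d - 1)"
proof -
  let ?V = "\<lambda>\<epsilon>. (1 + \<epsilon>) * sqrt (1 - 2 * \<epsilon> / (t - 1)) ^ (d - 1)"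
  have t: "1 < t" using assms by linarith
  define c where "c = 1 / (t - 1)"
  have V: "?V = (\<lambda>\<epsilon>. (1 + \<epsilon>) * sqrt (1 - 2 * c * \<epsilon>) ^ (d - 1))" by (simp add: c_def)
  have "(?V has_real_derivative 1 - (real d - 1) * c) (at 0)"
    unfolding V using assms(2) by (auto intro!: derivative_eq_intros simp: of_nat_diff)
  moreover have "0 < 1 - (real d - 1) * c" using t assms(1) by (simp add: c_def)
  ultimately obtain \<delta> where \<delta>: "0 < \<delta>" "\<And>h. 0 < h \<Longrightarrow> h < \<delta> \<Longrightarrow> ?V 0 < ?V (0 + h)"
    using DERIV_pos_inc_right[of ?V _ 0] by blast
  define \<epsilon> where "\<epsilon> = min (\<delta> / 2) ((t - 1) / 2)"
  have "0 < \<epsilon>" "\<epsilon> < \<delta>" "2 * \<epsilon> \<le> t - 1" using \<delta>(1) t by (auto simp: \<epsilon>_def min_def)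
  with \<delta>(2)[of \<epsilon>] that show thesis by simp
qed

lemma subset_scaled_maximal_ellipsoid:
  fixes K :: "(real^'n) set"
  assumes K: "convex K" "closed K" "ellipsoid A a \<subseteq> K" and "det A \<noteq> 0"
    and max: "\<And>B b. ellipsoid B b \<subseteq> K \<Longrightarrow> \<bar>det B\<bar> \<le> \<bar>det A\<bar>"
  shows "K \<subseteq> ellipsoid (real CARD('n) *\<^sub>R A) a"
proof
  fix x assume "x \<in> K"
  obtain B where B: "A ** B = mat 1"
    using \<open>det A \<noteq> 0\<close> by (metis invertible_det_nz invertible_def)
  define y where "y = B *v (x - a)"
  have x: "x = a + A *v y" by (simp add: y_def matrix_vector_mul_assoc B)
  have "norm y \<le> real CARD('n)"
  proof (rule ccontr)
    assume "\<not> norm y \<le> real CARD('n)"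
    then obtain \<epsilon> where \<epsilon>: "0 < \<epsilon>" "2 * \<epsilon> \<le> norm y - 1"
        "1 < (1 + \<epsilon>) * sqrt (1 - 2 * \<epsilon> / (norm y - 1)) ^ (CARD('n) - 1)"
      using ex_volume_increasing_stretch[of "CARD('n)" "norm y"] by (auto simp: Suc_le_eq)
    then obtain M c where "ellipsoid M c \<subseteq> K"
        "\<bar>det M\<bar> = \<bar>det A\<bar> * ((1 + \<epsilon>) * sqrt (1 - 2 * \<epsilon> / (norm y - 1)) ^ (CARD('n) - 1))"
      using enlarged_ellipsoid[OF K, of y "norm y" \<epsilon>] \<open>x \<in> K\<close> x by auto
    with max[of M c] \<epsilon>(3) \<open>det A \<noteq> 0\<close> show False by simp
  qed
  then show "x \<in> ellipsoid (real CARD('n) *\<^sub>R A) a"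
    unfolding x by (intro mem_ellipsoid_scaleR) auto
qed

theorem john_ellipsoid:
  fixes K :: "(real^'n) set"
  assumes "compact K" "convex K" "interior K \<noteq> {}"
  obtains A a where "positive_semidefinite A" "ellipsoid A a \<subseteq> K"
    "K \<subseteq> ellipsoid (real CARD('n) *\<^sub>R A) a"
proof -
  obtain A a where A: "ellipsoid A a \<subseteq> K" "det A \<noteq> 0" "\<And>B b. ellipsoid B b \<subseteq> K \<Longrightarrow> \<bar>det B\<bar> \<le> \<bar>det A\<bar>"
    using ex_maximal_inscribed_ellipsoid[OF assms(1,3)] by metis
  obtain R Q where R: "positive_semidefinite R" "orthogonal_matrix Q" "A = R ** Q"
    using polar_decomposition[OF A(2)] by blast
  have "K \<subseteq> ellipsoid (real CARD('n) *\<^sub>R A) a"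
    using assms A by (intro subset_scaled_maximal_ellipsoid) (auto simp: compact_imp_closed)
  then have "K \<subseteq> ellipsoid (real CARD('n) *\<^sub>R R) a"
    using R(2) by (simp add: R(3) scalar_matrix_assoc ellipsoid_matrix_mult_orthogonal)
  moreover have "ellipsoid R a \<subseteq> K"
    using A(1) R(2) by (simp add: R(3) ellipsoid_matrix_mult_orthogonal)
  ultimately show thesis using that R(1) by blast
qed

lemma det_scaleR: "det (c *\<^sub>R A) = c ^ CARD('n) * det A" for A :: "real^'n^'n"
proof -
  have "c *\<^sub>R A = matrix ((*\<^sub>R) c) ** A"
    by (simp add: matrix_eq matrix_vector_mul_assoc[symmetric] matrix_works linear_scaleR
        scaleR_matrix_vector_assoc)
  then show ?thesis by (simp add: det_mul)
qed

theorem inscribed_ellipsoid_of_volume: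
  fixes F :: "(real^'n) set"
  assumes F: "F \<in> sets lebesgue" "ennreal v \<le> emeasure lebesgue F" and "0 < v"
  obtains A a where "positive_semidefinite A"
    "v / (real CARD('n) ^ CARD('n) * unit_ball_vol (real CARD('n))) \<le> det A"
    "ellipsoid A a \<subseteq> closure (convex hull F)"
proof -
  let ?C = "closure (convex hull F)"
  have C: "convex ?C" "closed ?C" by (auto simp: convex_closure)
  have "F \<subseteq> ?C" using hull_subset closure_subset by (rule order_trans)
  then have "emeasure lebesgue F \<le> emeasure lebesgue ?C"
    by (intro emeasure_mono convex_imp_lebesgue_measurable C)
  with F(2) obtain K where K: "compact K" "convex K" "K \<subseteq> ?C" "v \<le> measure lebesgue K"
    using compact_convex_subset_measure_ge[OF C \<open>0 < v\<close>] order_trans by blast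
  have "interior K \<noteq> {}"
    using K(4) \<open>0 < v\<close> by (intro convex_positive_measure_imp_interior_nonempty K(2)) simp
  then obtain A a where A: "positive_semidefinite A" "ellipsoid A a \<subseteq> K"
      "K \<subseteq> ellipsoid (real CARD('n) *\<^sub>R A) a"
    using john_ellipsoid[OF K(1,2)] by blast
  have "measure lebesgue K \<le> measure lebesgue (ellipsoid (real CARD('n) *\<^sub>R A) a)"
    by (intro measure_mono_fmeasurable A(3) lmeasurable_ellipsoid fmeasurableD lmeasurable_compact K(1))
  also have "\<dots> = real CARD('n) ^ CARD('n) * (det A * unit_ball_vol (real CARD('n)))"
    using positive_semidefinite_det_nonneg[OF A(1)] by (simp add: measure_ellipsoid det_scaleR)
  finally have "v / (real CARD('n) ^ CARD('n) * unit_ball_vol (real CARD('n))) \<le> det A"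
    using K(4) by (simp add: divide_le_eq mult_ac)
  with A K(3) that show thesis by blast
qed

lemma emeasure_Inter_convex_ge_ellipsoid:
  fixes A :: "real^'n^'n"
  assumes "\<And>C. C \<in> \<C> \<Longrightarrow> convex C" "\<And>C. C \<in> \<C> \<Longrightarrow> ellipsoid A a \<subseteq> closure C"
  shows "ennreal (\<bar>det A\<bar> * unit_ball_vol (real CARD('n))) \<le> emeasure lebesgue (\<Inter>\<C>)"
proof -
  let ?E = "interior (ellipsoid A a)"
  have "?E \<subseteq> C" if "C \<in> \<C>" for C
    using interior_mono[OF assms(2)[OF that]] assms(1)[OF that] interior_subset
    by (auto simp: convex_interior_closure)
  then have "emeasure lebesgue ?E \<le> emeasure lebesgue (\<Inter>\<C>)"
    using assms(1) by (intro emeasure_mono convex_imp_lebesgue_measurable convex_Inter) auto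
  moreover have "measure lebesgue ?E = \<bar>det A\<bar> * unit_ball_vol (real CARD('n))"
    using measure_interior[OF bounded_ellipsoid negligible_convex_frontier[OF convex_ellipsoid], of A a]
    by (simp add: measure_ellipsoid)
  moreover have "?E \<in> lmeasurable" by (simp add: bounded_ellipsoid lmeasurable_interior)
  ultimately show ?thesis by (simp add: emeasure_eq_measure2)
qed

section \<open>Tverberg's theorem with volume\<close>

lemma card_one_or_two_element_subsets:
  "card {S :: 'n::finite set. card S = 1 \<or> card S = 2} = CARD('n) * (CARD('n) + 1) div 2"
proof -
  let ?T = "\<lambda>k. {S :: 'n set. S \<subseteq> UNIV \<and> card S = k}"
  have "{S :: 'n set. card S = 1 \<or> card S = 2} = ?T 1 \<union> ?T 2" by auto
  also have "card (?T 1 \<union> ?T 2) = card (?T 1) + card (?T 2)"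
    by (rule card_Un_disjoint) auto
  also have "\<dots> = CARD('n) + CARD('n) * (CARD('n) - 1) div 2"
    using n_subsets[of "UNIV :: 'n set" 1] n_subsets[of "UNIV :: 'n set" 2] by (simp add: choose_two)
  also have "\<dots> = CARD('n) * (CARD('n) + 1) div 2"
    by (cases "CARD('n)") (auto simp: algebra_simps)
  finally show ?thesis .
qed

lemma subspace_symmetric_matrices: "subspace {A :: real^'n^'n. transpose A = A}"
  by (auto simp: subspace_def transpose_def vec_eq_iff)

lemma matrix_eq_sum_units: "A = (\<Sum>p\<in>UNIV. \<Sum>q\<in>UNIV. A $ p $ q *\<^sub>R axis p (axis q 1))"
  for A :: "real^'n^'m"
proof -
  have "(\<Sum>q\<in>UNIV. A $ p $ q *\<^sub>R axis p (axis q 1)) $ i $ j = (if i = p then A $ p $ j else 0)" for p i j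
    by (cases "i = p") (simp_all add: axis_def if_distrib[of "\<lambda>u. _ * u"] cong: if_cong)
  then show ?thesis by (simp add: vec_eq_iff)
qed

lemma dim_symmetric_matrices_le:
  "dim {A :: real^'n^'n. transpose A = A} \<le> CARD('n) * (CARD('n) + 1) div 2"
proof -
  define u :: "'n set \<Rightarrow> real^'n^'n" where "u S = (\<chi> i j. of_bool ({i, j} = S))" for S
  let ?T = "{S :: 'n set. card S = 1 \<or> card S = 2}"
  have unit: "axis p (axis q 1) + axis q (axis p 1) \<in> span (u ` ?T)" for p q
  proof -
    have "axis p (axis q 1) + axis q (axis p 1) = (if p = q then 2 else 1) *\<^sub>R u {p, q}"
      by (auto simp: u_def vec_eq_iff axis_def doubleton_eq_iff)
    moreover have "{p, q} \<in> ?T" by (cases "p = q") auto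
    ultimately show ?thesis by (simp add: span_base span_scale)
  qed
  have "A \<in> span (u ` ?T)" if "transpose A = A" for A
  proof -
    have "transpose A = (\<Sum>p\<in>UNIV. \<Sum>q\<in>UNIV. A $ p $ q *\<^sub>R axis q (axis p 1))"
      by (subst matrix_eq_sum_units, subst sum.swap) (simp add: transpose_def)
    moreover have "2 *\<^sub>R A = A + transpose A" by (simp add: that scaleR_2)
    ultimately have "2 *\<^sub>R A = (\<Sum>p\<in>UNIV. \<Sum>q\<in>UNIV. A $ p $ q *\<^sub>R (axis p (axis q 1) + axis q (axis p 1)))"
      unfolding scaleR_add_right sum.distrib using matrix_eq_sum_units[of A] by metis
    also have "\<dots> \<in> span (u ` ?T)" by (intro span_sum span_scale unit)
    finally show ?thesis using span_scale[of "2 *\<^sub>R A" _ "1 / 2"] by simp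
  qed
  then have "dim {A :: real^'n^'n. transpose A = A} \<le> card (u ` ?T)"
    by (intro dim_le_card) auto
  also have "\<dots> \<le> card ?T" by (rule card_image_le) simp
  finally show ?thesis by (simp only: card_one_or_two_element_subsets)
qed

lemma dim_symmetric_matrices_Times_vectors_le:
  "dim ({A :: real^'n^'n. transpose A = A} \<times> (UNIV :: (real^'n) set)) \<le> CARD('n) * (CARD('n) + 3) div 2"
proof -
  have "dim ({A :: real^'n^'n. transpose A = A} \<times> (UNIV :: (real^'n) set)) =
      dim {A :: real^'n^'n. transpose A = A} + CARD('n)"
    by (simp add: dim_Times[OF subspace_symmetric_matrices subspace_UNIV])
  also have "\<dots> \<le> CARD('n) * (CARD('n) + 1) div 2 + CARD('n)"
    using dim_symmetric_matrices_le by simp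
  also have "\<dots> = CARD('n) * (CARD('n) + 3) div 2" by (simp add: algebra_simps)
  finally show ?thesis .
qed

lemma ellipsoid_combination_subset_closure_convex_hull:
  fixes F :: "'i \<Rightarrow> (real^'n) set"
  assumes "(S, s) \<in> convex hull ((\<lambda>i. (A i, a i)) ` B)"
    and inscribed: "\<And>i. i \<in> B \<Longrightarrow> ellipsoid (A i) (a i) \<subseteq> closure (convex hull F i)"
  shows "ellipsoid S s \<subseteq> closure (convex hull (\<Union>i\<in>B. F i))"
proof -
  let ?G = "{(A, a). ellipsoid A a \<subseteq> closure (convex hull (\<Union>i\<in>B. F i))}"
  have "closure (convex hull F i) \<subseteq> closure (convex hull (\<Union>i\<in>B. F i))" if "i \<in> B" for i
    using that by (intro closure_mono hull_mono) auto
  then have "(\<lambda>i. (A i, a i)) ` B \<subseteq> ?G" using inscribed by fastforce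
  then have "convex hull ((\<lambda>i. (A i, a i)) ` B) \<subseteq> ?G"
    by (intro hull_minimal convex_inscribed_ellipsoids convex_closure convex_convex_hull)
  with assms(1) show ?thesis by blast
qed

theorem tverberg_volume:
  fixes F :: "'i \<Rightarrow> (real^'d) set"
  assumes "finite I" "0 < r" and large: "(r - 1) * (CARD('d) * (CARD('d) + 3) div 2 + 1) < card I"
    and "0 < v" and F: "\<And>i. i \<in> I \<Longrightarrow> F i \<in> sets lebesgue" "\<And>i. i \<in> I \<Longrightarrow> ennreal v \<le> emeasure lebesgue (F i)"
  obtains P where "partition_on I P" "card P = r"
    "ennreal (v / real CARD('d) ^ CARD('d)) \<le> emeasure lebesgue (\<Inter>B\<in>P. convex hull (\<Union>i\<in>B. F i))"
proof -
  define \<kappa> where "\<kappa> = v / (real CARD('d) ^ CARD('d) * unit_ball_vol (real CARD('d)))"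
  have "\<exists>A a. positive_semidefinite A \<and> \<kappa> \<le> det A \<and> ellipsoid A a \<subseteq> closure (convex hull F i)"
    if "i \<in> I" for i
    using inscribed_ellipsoid_of_volume[OF F[OF that] \<open>0 < v\<close>] unfolding \<kappa>_def by metis
  then obtain A a where A: "\<And>i. i \<in> I \<Longrightarrow> positive_semidefinite (A i) \<and> \<kappa> \<le> det (A i)"
      "\<And>i. i \<in> I \<Longrightarrow> ellipsoid (A i) (a i) \<subseteq> closure (convex hull F i)"
    by metis
  define x where "x i = (A i, a i)" for i
  have "x ` I \<subseteq> {A. transpose A = A} \<times> UNIV"
    using A(1) by (auto simp: x_def positive_semidefinite_def)
  then have "dim (x ` I) \<le> CARD('d) * (CARD('d) + 3) div 2"
    using dim_subset dim_symmetric_matrices_Times_vectors_le order_trans by blast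
  then have "(r - 1) * (dim (x ` I) + 1) \<le> (r - 1) * (CARD('d) * (CARD('d) + 3) div 2 + 1)"
    by (intro mult_le_mono2) simp
  then have "(r - 1) * (dim (x ` I) + 1) < card I" using large by (rule le_less_trans)
  then obtain P S s where P: "partition_on I P" "card P = r"
    and Ss: "\<And>B. B \<in> P \<Longrightarrow> (S, s) \<in> convex hull (x ` B)"
    using tverberg[OF assms(1,2)] by (metis surj_pair)
  then have sub: "B \<subseteq> I" if "B \<in> P" for B using that by (auto simp: partition_on_def)
  have "ellipsoid S s \<subseteq> closure (convex hull (\<Union>i\<in>B. F i))" if "B \<in> P" for B
    using Ss[OF that] sub[OF that] A(2) unfolding x_def
    by (intro ellipsoid_combination_subset_closure_convex_hull) auto
  then have vol: "ennreal (\<bar>det S\<bar> * unit_ball_vol (real CARD('d)))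
      \<le> emeasure lebesgue (\<Inter>B\<in>P. convex hull (\<Union>i\<in>B. F i))"
    by (intro emeasure_Inter_convex_ge_ellipsoid) (auto intro: convex_convex_hull)
  obtain B where "B \<in> P" using P(2) \<open>0 < r\<close> by fastforce
  have "convex hull (x ` B) \<subseteq> {A. positive_semidefinite A \<and> \<kappa> \<le> det A} \<times> UNIV"
    using A(1) sub[OF \<open>B \<in> P\<close>]
    by (intro hull_minimal convex_Times convex_positive_semidefinite_det_ge) (auto simp: x_def)
  with Ss[OF \<open>B \<in> P\<close>] have "\<kappa> \<le> \<bar>det S\<bar>" by fastforce
  then have "v / real CARD('d) ^ CARD('d) \<le> \<bar>det S\<bar> * unit_ball_vol (real CARD('d))"
    by (simp add: \<kappa>_def divide_le_eq mult_ac)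
  with vol have "ennreal (v / real CARD('d) ^ CARD('d)) \<le> emeasure lebesgue (\<Inter>B\<in>P. convex hull (\<Union>i\<in>B. F i))"
    using ennreal_leI order_trans by blast
  with P show thesis by (rule that)
qed

theorem theorem1p1:
  fixes r :: nat
    and I :: "'i set"
    and F :: "'i \<Rightarrow> (real ^ 'd) set"
  assumes "r \<ge> 1"
    and "card I = (r - 1) * (CARD('d) * (CARD('d) + 3) div 2 + 1) + 1"
    and "\<And>i. i \<in> I \<Longrightarrow> F i \<in> sets lebesgue"
    and "\<And>i. i \<in> I \<Longrightarrow> emeasure lebesgue (F i) = 1"
  shows "\<exists>P. partition_on I P \<and> card P = r \<and>
           emeasure lebesgue (\<Inter>A\<in>P. convex hull (\<Union>i\<in>A. F i))
             \<ge> ennreal (1 / real CARD('d) ^ CARD('d))"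
proof -
  have "finite I" using assms(2) by (metis add_is_0 card.infinite one_neq_zero)
  moreover have "(r - 1) * (CARD('d) * (CARD('d) + 3) div 2 + 1) < card I"
    using assms(2) by simp
  moreover have "ennreal 1 \<le> emeasure lebesgue (F i)" if "i \<in> I" for i
    by (simp add: assms(4)[OF that])
  ultimately obtain P where "partition_on I P" "card P = r"
      "ennreal (1 / real CARD('d) ^ CARD('d)) \<le> emeasure lebesgue (\<Inter>A\<in>P. convex hull (\<Union>i\<in>A. F i))"
    using tverberg_volume[of I r 1 F] assms(1,3) by auto
  then show ?thesis by blast
qed

end
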